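(* Let $L$ be a non-degenerate 4-bar linkage and let $t>0$. Then there exists a unique convex configuration in $M(L)$ which is a critical point of $E=E_t$ on $M(L)$. This configuration is the global minimum point of $E_t$ on $M(L)$, and it depends continuously on $t\in(0,\infty)$.
   Context: A 4-bar linkage $L=L(a,b,c,d)$ is given by positive sidelengths $a,b,c,d$. Its moduli space is $M(L)=\{(p_1,p_2,p_3,p_4)\in(\mathbb{R}^2)^4 : |p_1p_2|=a,\ |p_2p_3|=b,\ |p_3p_4|=c,\ |p_4p_1|=d\}/\mathrm{Iso}(\mathbb{R}^2)$, the quotient by all isometries of the plane (including orientation-reversing ones). $L$ is assumed to have configurations ($M(L)\neq\emptyset$). Non-degenerate means that no configuration of $L$ has all its vertices on one line; in this case $M(L)$ is a smooth closed curve homeomorphic to a circle. $M^C(L)\subset M(L)$ is the set of convex configurations, where non-strictly convex polygons (some angle equal to $\pi$) are allowed. For a configuration put $x=|p_1p_3|$ and $y=|p_2p_4|$. A controlling charge $t$ is placed at vertex $p_1$ and charges $+1$ at $p_2,p_3,p_4$; the (effective) Coulomb potential is the function $E_t:M(L)\to\mathbb{R}$, $E_t=\frac{t}{x}+\frac1y$. Critical points are those of $E_t$ as a smooth function on $M(L)$. *)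

theory Defs
  imports "HOL-Analysis.Analysis"
begin

type_synonym plane = "real^2"
type_synonym config = "plane \<times> plane \<times> plane \<times> plane"

section \<open>Configurations and moduli space of a 4-bar linkage\<close>

definition configurations :: "real \<Rightarrow> real \<Rightarrow> real \<Rightarrow> real \<Rightarrow> config set" where
  "configurations a b c d =
     {(p1, p2, p3, p4). dist p1 p2 = a \<and> dist p2 p3 = b \<and> dist p3 p4 = c \<and> dist p4 p1 = d}"

text \<open>Distance-preserving self-maps of the plane are automatically bijective, so the
  following set is the full isometry group of the plane, reflections included.\<close>

definition plane_isometries :: "(plane \<Rightarrow> plane) set" where
  "plane_isometries = {f. \<forall>u v. dist (f u) (f v) = dist u v}"

definition config_class :: "config \<Rightarrow> config set" where
  "config_class = (\<lambda>(p1, p2, p3, p4). {(f p1, f p2, f p3, f p4) | f. f \<in> plane_isometries})"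

definition moduli_space :: "real \<Rightarrow> real \<Rightarrow> real \<Rightarrow> real \<Rightarrow> config set set" where
  "moduli_space a b c d = config_class ` configurations a b c d"

definition quotient_topology :: "'a topology \<Rightarrow> ('a \<Rightarrow> 'b) \<Rightarrow> 'b topology" where
  "quotient_topology X f =
     topology (\<lambda>U. U \<subseteq> f ` topspace X \<and> openin X {x \<in> topspace X. f x \<in> U})"

lemma openin_quotient_topology:
  "openin (quotient_topology X f) U \<longleftrightarrow>
     U \<subseteq> f ` topspace X \<and> openin X {x \<in> topspace X. f x \<in> U}"
proof -
  have "istopology (\<lambda>U. U \<subseteq> f ` topspace X \<and> openin X {x \<in> topspace X. f x \<in> U})"
    unfolding istopology_def
  proof (intro conjI allI impI)
    fix S T
    assume S: "S \<subseteq> f ` topspace X \<and> openin X {x \<in> topspace X. f x \<in> S}"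
      and T: "T \<subseteq> f ` topspace X \<and> openin X {x \<in> topspace X. f x \<in> T}"
    show "S \<inter> T \<subseteq> f ` topspace X"
      using S by blast
    have "{x \<in> topspace X. f x \<in> S \<inter> T} =
        {x \<in> topspace X. f x \<in> S} \<inter> {x \<in> topspace X. f x \<in> T}"
      by blast
    then show "openin X {x \<in> topspace X. f x \<in> S \<inter> T}"
      using S T openin_Int[of X "{x \<in> topspace X. f x \<in> S}" "{x \<in> topspace X. f x \<in> T}"]
      by (simp only:)
  next
    fix \<K>
    assume K: "\<forall>S\<in>\<K>. S \<subseteq> f ` topspace X \<and> openin X {x \<in> topspace X. f x \<in> S}"
    show "\<Union>\<K> \<subseteq> f ` topspace X"
      using K by blast
    have "{x \<in> topspace X. f x \<in> \<Union>\<K>} = (\<Union>S\<in>\<K>. {x \<in> topspace X. f x \<in> S})"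
      by blast
    then show "openin X {x \<in> topspace X. f x \<in> \<Union>\<K>}"
      using K by (metis (no_types, lifting) openin_Union image_iff)
  qed
  then show ?thesis
    by (simp add: quotient_topology_def)
qed

lemma topspace_quotient_topology: "topspace (quotient_topology X f) = f ` topspace X"
proof
  show "topspace (quotient_topology X f) \<subseteq> f ` topspace X"
    using openin_topspace[of "quotient_topology X f"] unfolding openin_quotient_topology
    by (rule conjunct1)
  have "{x \<in> topspace X. f x \<in> f ` topspace X} = topspace X"
    by blast
  then have "openin (quotient_topology X f) (f ` topspace X)"
    by (simp add: openin_quotient_topology)
  then show "f ` topspace X \<subseteq> topspace (quotient_topology X f)"
    by (rule openin_subset)
qed

lemma quotient_map_quotient_topology: "quotient_map X (quotient_topology X f) f"
  by (simp add: quotient_map_def openin_quotient_topology topspace_quotient_topology)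

definition moduli_topology :: "real \<Rightarrow> real \<Rightarrow> real \<Rightarrow> real \<Rightarrow> config set topology" where
  "moduli_topology a b c d =
     quotient_topology (top_of_set (configurations a b c d)) config_class"

lemma topspace_moduli_topology: "topspace (moduli_topology a b c d) = moduli_space a b c d"
  by (simp add: moduli_topology_def topspace_quotient_topology moduli_space_def)

definition nondegenerate :: "real \<Rightarrow> real \<Rightarrow> real \<Rightarrow> real \<Rightarrow> bool" where
  "nondegenerate a b c d \<longleftrightarrow>
     (\<forall>(p1, p2, p3, p4) \<in> configurations a b c d. \<not> collinear {p1, p2, p3, p4})"

section \<open>Convex configurations\<close>

text \<open>A polygon is convex if it is the whole boundary of a convex region; interior angles
  equal to \<open>\<pi>\<close> are thereby allowed.\<close>

definition convex_config :: "config \<Rightarrow> bool" where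
  "convex_config = (\<lambda>(p1, p2, p3, p4).
     \<exists>K. convex K \<and> interior K \<noteq> {} \<and>
       frontier K = closed_segment p1 p2 \<union> closed_segment p2 p3
                    \<union> closed_segment p3 p4 \<union> closed_segment p4 p1)"

definition convex_moduli_space :: "real \<Rightarrow> real \<Rightarrow> real \<Rightarrow> real \<Rightarrow> config set set" where
  "convex_moduli_space a b c d = config_class ` {p \<in> configurations a b c d. convex_config p}"

section \<open>The Coulomb potential and its critical points\<close>

text \<open>If \<open>p1 = p3\<close> or \<open>p2 = p4\<close> for some configuration, then the linkage also has a
  collinear one. So for a non-degenerate linkage no denominator below vanishes.\<close>

definition config_potential :: "real \<Rightarrow> config \<Rightarrow> real" where
  "config_potential t = (\<lambda>(p1, p2, p3, p4). t / dist p1 p3 + 1 / dist p2 p4)"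

definition coulomb_potential :: "real \<Rightarrow> config set \<Rightarrow> real" where
  "coulomb_potential t m = config_potential t (SOME p. p \<in> m)"

lemma coulomb_potential_config_class:
  "coulomb_potential t (config_class p) = config_potential t p"
proof -
  obtain p1 p2 p3 p4 where p: "p = (p1, p2, p3, p4)"
    by (cases p)
  have "(\<lambda>u. u) \<in> plane_isometries"
    by (simp add: plane_isometries_def)
  then have "\<exists>f. (p1, p2, p3, p4) = (f p1, f p2, f p3, f p4) \<and> f \<in> plane_isometries"
    by (intro exI[of _ "\<lambda>u. u"]) simp
  then have "p \<in> config_class p"
    unfolding p config_class_def case_prod_conv by (rule CollectI)
  then have "(SOME q. q \<in> config_class p) \<in> config_class p"
    by (rule someI)
  moreover have "config_potential t q = config_potential t p" if "q \<in> config_class p" for q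
    using that
    by (auto simp: p config_class_def config_potential_def plane_isometries_def)
  ultimately show ?thesis
    by (simp add: coulomb_potential_def)
qed

text \<open>For a non-degenerate linkage the isometry group acts freely on the manifold of
  configurations, so the projection \<open>config_class\<close> to the quotient manifold is a submersion
  and every tangent vector of the moduli space is the velocity of the projection of a
  \<open>C\<^sup>1\<close> curve of configurations. A critical point of \<open>F\<close> is a point at which the derivative
  of \<open>F\<close> along all these tangent vectors vanishes.\<close>

definition critical_point ::
    "real \<Rightarrow> real \<Rightarrow> real \<Rightarrow> real \<Rightarrow> (config set \<Rightarrow> real) \<Rightarrow> config set \<Rightarrow> bool" where
  "critical_point a b c d F m \<longleftrightarrow>
     m \<in> moduli_space a b c d \<and>
     (\<forall>(\<gamma> :: real \<Rightarrow> config) \<epsilon>.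
        \<epsilon> > 0 \<and> \<gamma> C1_differentiable_on {-\<epsilon><..<\<epsilon>} \<and>
        \<gamma> ` {-\<epsilon><..<\<epsilon>} \<subseteq> configurations a b c d \<and> config_class (\<gamma> 0) = m
        \<longrightarrow> ((\<lambda>s. F (config_class (\<gamma> s))) has_real_derivative 0) (at 0))"

end

theory Submission
  imports Defs
begin

text \<open>Write \<open>x\<close> and \<open>y\<close> for the two diagonals of a configuration. The idea is to look at the
  linkage in the plane of the squared diagonals \<open>(x\<^sup>2, y\<^sup>2)\<close>, in which two kinds of convexity
  meet.

  First, the potential \<open>t / x + 1 / y\<close> is a strictly convex function of \<open>(x\<^sup>2, y\<^sup>2)\<close>, strictly
  decreasing in both variables (\<open>potential_strict_min_of_support\<close>).

  Secondly, a convex configuration \<open>p\<close> carries a stress. Its vertices satisfy an affine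
  dependency \<open>\<Sum>i. w\<^sub>i p\<^sub>i = 0\<close>, \<open>\<Sum>i. w\<^sub>i = 0\<close>, and for every configuration \<open>q\<close> one has
  \<open>\<Sum>i<j. w\<^sub>i w\<^sub>j |q\<^sub>i - q\<^sub>j|\<^sup>2 = - |\<Sum>i. w\<^sub>i q\<^sub>i|\<^sup>2 \<le> 0\<close>, with equality at \<open>p\<close>. As the sides are
  fixed, this bounds the linear functional \<open>w\<^sub>1 w\<^sub>3 x\<^sup>2 + w\<^sub>2 w\<^sub>4 y\<^sup>2\<close> on the whole linkage by its
  value at \<open>p\<close> (\<open>stress_inequality\<close>). Convexity of \<open>p\<close> means that its diagonals cross, that
  is, that both coefficients are non-negative (\<open>convex_iff_diagonals_cross\<close>).

  If \<open>p\<close> is moreover critical, the differentials of this functional and of the potential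
  are proportional along the moduli space, because there is a motion through \<open>p\<close> that changes
  the diagonals at non-zero speed (\<open>diagonals_move\<close>). So the supporting line is the tangent to
  the level curve of the potential, and \<open>p\<close> is the only global minimum, up to congruence
  (\<open>critical_crossing_is_strict_min\<close>, \<open>config_class_eqI\<close>).

  Conversely, a global minimum exists by compactness and is critical. It is convex: if two
  opposite vertices lay on the same side of the diagonal through the other two, reflecting
  one of them in that diagonal would lower the potential
  (\<open>minimal_config_diagonals_cross\<close>). Finally, the unique minimizer over a compact space
  depends continuously on the parameter (\<open>minimizer_class_continuous\<close>).\<close>

section \<open>Orientation determinants in the plane\<close>

definition rot90 :: "plane \<Rightarrow> plane" where
  "rot90 z = vector [- z$2, z$1]"

definition orient :: "plane \<Rightarrow> plane \<Rightarrow> plane \<Rightarrow> real" where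
  "orient p q r = rot90 (q - p) \<bullet> (r - p)"

lemma inner_plane: "u \<bullet> v = u$1 * v$1 + u$2 * v$2" for u v :: plane
  by (simp add: inner_vec_def sum_2)

lemma dist_plane_sq: "(dist u v)\<^sup>2 = (u$1 - v$1)\<^sup>2 + (u$2 - v$2)\<^sup>2" for u v :: plane
  by (simp only: dist_norm power2_norm_eq_inner inner_plane) (simp add: power2_eq_square)

lemma rot90_component [simp]: "rot90 z $ 1 = - z$2" "rot90 z $ 2 = z$1"
  by (simp_all add: rot90_def)

lemma orient_coords: "orient p q r = (q$1 - p$1) * (r$2 - p$2) - (q$2 - p$2) * (r$1 - p$1)"
  by (simp add: orient_def inner_plane algebra_simps)

lemma plane_eqI: "u$1 = v$1 \<Longrightarrow> u$2 = v$2 \<Longrightarrow> u = v" for u v :: plane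
  by (simp add: vec_eq_iff forall_2)

lemma rot90_eq_0_iff [simp]: "rot90 z = 0 \<longleftrightarrow> z = 0"
  by (auto simp: vec_eq_iff forall_2)

lemma orient_rotate: "orient q r p = orient p q r"
  by (simp add: orient_coords algebra_simps)

text \<open>Both sides are twice the signed area of the quadrilateral, cut along its two diagonals.\<close>

lemma orient_sum: "orient p2 p3 p4 + orient p1 p2 p4 = orient p1 p3 p4 + orient p1 p2 p3"
  by (simp add: orient_coords algebra_simps)

text \<open>Coordinates with respect to the orthogonal frame formed by a vector and its quarter turn.\<close>

lemma plane_decomp:
  assumes "e \<noteq> (0::plane)"
  shows "z = ((e \<bullet> z) / (e \<bullet> e)) *\<^sub>R e + ((rot90 e \<bullet> z) / (e \<bullet> e)) *\<^sub>R rot90 e"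
proof -
  have ne: "e \<bullet> e \<noteq> 0"
    using assms by simp
  have "(e \<bullet> e) *\<^sub>R z = (e \<bullet> z) *\<^sub>R e + (rot90 e \<bullet> z) *\<^sub>R rot90 e"
    by (rule plane_eqI) (simp_all add: inner_plane algebra_simps)
  then have "z = (1 / (e \<bullet> e)) *\<^sub>R ((e \<bullet> z) *\<^sub>R e + (rot90 e \<bullet> z) *\<^sub>R rot90 e)"
    using ne by (metis divideR_right scaleR_conv_of_real scaleR_one scaleR_scaleR nonzero_divide_eq_eq)
  then show ?thesis
    by (simp add: scaleR_add_right)
qed

lemma orient_eq_0_iff_on_line:
  assumes "p \<noteq> q"
  shows "orient p q r = 0 \<longleftrightarrow> (\<exists>s. r = p + s *\<^sub>R (q - p))"
proof
  assume "orient p q r = 0"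
  then have "r - p = (((q - p) \<bullet> (r - p)) / ((q - p) \<bullet> (q - p))) *\<^sub>R (q - p)"
    using plane_decomp[of "q - p" "r - p"] assms by (simp add: orient_def)
  then show "\<exists>s. r = p + s *\<^sub>R (q - p)"
    by (metis add_diff_cancel_left' diff_add_cancel add.commute)
next
  assume "\<exists>s. r = p + s *\<^sub>R (q - p)"
  then show "orient p q r = 0"
    by (elim exE) (simp add: orient_coords)
qed

lemma orient_eq_0_imp_collinear: "orient p q r = 0 \<Longrightarrow> collinear {p, q, r}"
proof (cases "p = q")
  case False
  assume "orient p q r = 0"
  then obtain s where s: "r = p + s *\<^sub>R (q - p)"
    using orient_eq_0_iff_on_line[OF False] by blast
  show ?thesis
    unfolding collinear_alt
    by (rule exI[of _ p], rule exI[of _ "q - p"], safe)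
       (metis add.right_neutral scale_zero_left, metis scale_one add_diff_cancel_left' diff_add_cancel add.commute, metis s)
qed simp

lemma two_orients_0_imp_collinear:
  assumes "p \<noteq> q" "orient p q r = 0" "orient p q s = 0"
  shows "collinear {p, q, r, s}"
  using assms by (simp add: collinear_4_3 orient_eq_0_imp_collinear)

section \<open>The stress of a quadrilateral\<close>

text \<open>For weights of sum zero the quadratic form \<open>\<Sum>i<j. w\<^sub>i w\<^sub>j |q\<^sub>i - q\<^sub>j|\<^sup>2\<close> is
  the negative of a square, hence everywhere at most zero. It vanishes exactly at the
  configurations for which the weights form an affine dependency.\<close>

lemma stress_identity:
  fixes q1 q2 q3 q4 :: plane
  assumes "w1 + w2 + w3 + w4 = 0"
  shows "w1 * w2 * (dist q1 q2)\<^sup>2 + w2 * w3 * (dist q2 q3)\<^sup>2 + w3 * w4 * (dist q3 q4)\<^sup>2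
    + w4 * w1 * (dist q4 q1)\<^sup>2 + w1 * w3 * (dist q1 q3)\<^sup>2 + w2 * w4 * (dist q2 q4)\<^sup>2
    = - (norm (w1 *\<^sub>R q1 + w2 *\<^sub>R q2 + w3 *\<^sub>R q3 + w4 *\<^sub>R q4))\<^sup>2"
proof -
  have w4: "w4 = - w1 - w2 - w3" using assms by simp
  show ?thesis
    unfolding w4 dist_plane_sq power2_norm_eq_inner inner_plane
    by (simp add: power2_eq_square algebra_simps)
qed

lemma orient_dependency:
  "orient p2 p3 p4 *\<^sub>R p1 + (- orient p1 p3 p4) *\<^sub>R p2 + orient p1 p2 p4 *\<^sub>R p3 + (- orient p1 p2 p3) *\<^sub>R p4 = 0"
  by (rule plane_eqI) (simp_all add: orient_coords algebra_simps)

text \<open>The signed areas of the four triangles are the weights of an affine dependency of the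
  vertices of \<open>p\<close>. With these weights the form of \<open>stress_identity\<close> vanishes at \<open>p\<close>, and it is at
  most zero at \<open>q\<close>; the sides contribute equally to both values, and only the diagonals
  remain. In the plane of the squared diagonals this is a supporting line at \<open>p\<close> for the
  set of all pairs that the linkage can attain.\<close>

lemma stress_inequality:
  assumes p: "(p1, p2, p3, p4) \<in> configurations a b c d"
    and q: "(q1, q2, q3, q4) \<in> configurations a b c d"
  shows "orient p2 p3 p4 * orient p1 p2 p4 * ((dist q1 q3)\<^sup>2 - (dist p1 p3)\<^sup>2)
    + orient p1 p3 p4 * orient p1 p2 p3 * ((dist q2 q4)\<^sup>2 - (dist p2 p4)\<^sup>2) \<le> 0"
proof -
  define w1 w2 w3 w4 where w: "w1 = orient p2 p3 p4" "w2 = - orient p1 p3 p4"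
    "w3 = orient p1 p2 p4" "w4 = - orient p1 p2 p3"
  have sum: "w1 + w2 + w3 + w4 = 0"
    using orient_sum[of p2 p3 p4 p1] by (simp add: w)
  have dep: "w1 *\<^sub>R p1 + w2 *\<^sub>R p2 + w3 *\<^sub>R p3 + w4 *\<^sub>R p4 = 0"
    unfolding w by (rule orient_dependency)
  have "w1 * w3 * ((dist q1 q3)\<^sup>2 - (dist p1 p3)\<^sup>2) + w2 * w4 * ((dist q2 q4)\<^sup>2 - (dist p2 p4)\<^sup>2)
    = - (norm (w1 *\<^sub>R q1 + w2 *\<^sub>R q2 + w3 *\<^sub>R q3 + w4 *\<^sub>R q4))\<^sup>2"
    using stress_identity[OF sum, of p1 p2 p3 p4] stress_identity[OF sum, of q1 q2 q3 q4] p q dep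
    by (simp add: configurations_def algebra_simps)
  also have "\<dots> \<le> 0" by simp
  finally show ?thesis by (simp add: w)
qed

section \<open>Convex quadrilaterals are those whose diagonals cross\<close>

text \<open>Each product compares the sides of one diagonal on which the other two vertices
  lie: the vertices \<open>p1\<close>, \<open>p3\<close> are (weakly) separated by the line \<open>p2p4\<close>, and \<open>p2\<close>, \<open>p4\<close>
  by the line \<open>p1p3\<close>. The two products are the coefficients in \<open>stress_inequality\<close>, so the
  condition says that the normal of the supporting line points to longer diagonals.\<close>

definition diagonals_cross :: "config \<Rightarrow> bool" where
  "diagonals_cross = (\<lambda>(p1, p2, p3, p4).
     orient p2 p3 p4 * orient p1 p2 p4 \<ge> 0 \<and> orient p1 p3 p4 * orient p1 p2 p3 \<ge> 0)"

lemma configurations_rotate: "(p1, p2, p3, p4) \<in> configurations a b c d \<longleftrightarrow> (p2, p3, p4, p1) \<in> configurations b c d a"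
  by (auto simp: configurations_def)

text \<open>A supporting line of the region at the midpoint of an edge must contain the whole edge,
  since its linear functional is minimal at an interior point of that segment. So the
  remaining vertices lie on one side of the edge.\<close>

lemma edge_supports:
  assumes K: "convex K" "interior K \<noteq> {}"
    and seg: "closed_segment p q \<subseteq> frontier K" and rs: "r \<in> frontier K" "s \<in> frontier K"
    and "p \<noteq> q"
  shows "orient p q r * orient p q s \<ge> 0"
proof -
  have fr: "x \<in> closure K" if "x \<in> frontier K" for x
    using that by (simp add: frontier_def)
  have m: "midpoint p q \<in> frontier K"
    using seg by auto
  then have nri: "midpoint p q \<notin> rel_interior K"
    using K by (simp add: frontier_def rel_interior_nonempty_interior)
  obtain n where "n \<noteq> 0" and n: "\<And>y. y \<in> closure K \<Longrightarrow> n \<bullet> midpoint p q \<le> n \<bullet> y"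
    by (rule supporting_hyperplane_relative_frontier[OF K(1) fr[OF m] nri]) (rule that)
  have mid: "n \<bullet> midpoint p q = (n \<bullet> p + n \<bullet> q) / 2"
    by (simp add: midpoint_def inner_add_right)
  have pq: "p \<in> closure K" "q \<in> closure K"
    using seg by (auto intro!: fr)
  have eq: "n \<bullet> p = n \<bullet> q"
    using n[OF pq(1)] n[OF pq(2)] mid by simp
  define k where "k = (rot90 (q - p) \<bullet> n) / ((q - p) \<bullet> (q - p))"
  have nk: "n = k *\<^sub>R rot90 (q - p)"
  proof -
    have "(q - p) \<bullet> n = 0"
      using eq by (simp add: inner_diff_left inner_commute[of p n] inner_commute[of q n])
    moreover have "n = (((q - p) \<bullet> n) / ((q - p) \<bullet> (q - p))) *\<^sub>R (q - p) + k *\<^sub>R rot90 (q - p)"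
      unfolding k_def using \<open>p \<noteq> q\<close> by (intro plane_decomp) simp
    ultimately show ?thesis
      by (metis add_0 div_0 scale_zero_left)
  qed
  have "k \<noteq> 0"
    using nk \<open>n \<noteq> 0\<close> by auto
  have pos: "k * orient p q y \<ge> 0" if "y \<in> frontier K" for y
  proof -
    have "k * orient p q y = n \<bullet> (y - p)"
      by (simp add: orient_def nk)
    also have "\<dots> \<ge> 0"
      using n[OF fr[OF that]] mid eq by (simp add: inner_diff_right)
    finally show ?thesis .
  qed
  have "0 \<le> (k * orient p q r) * (k * orient p q s)"
    using pos rs by simp
  also have "\<dots> = k\<^sup>2 * (orient p q r * orient p q s)"
    by (simp add: power2_eq_square)
  finally show ?thesis
    using \<open>k \<noteq> 0\<close> by (simp add: zero_le_mult_iff)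
qed

text \<open>Each edge has the other two vertices on one side, so cyclically adjacent weights of the
  affine dependency have opposite signs or vanish. If two opposite weights had strictly
  opposite signs, both other weights would be zero, and the polygon would be flat.\<close>

lemma convex_config_imp_diagonals_cross:
  assumes conv: "convex_config (p1, p2, p3, p4)"
    and ne: "p1 \<noteq> p2" "p2 \<noteq> p3" "p3 \<noteq> p4" "p4 \<noteq> p1" "p1 \<noteq> p3" "p2 \<noteq> p4"
    and nc: "\<not> collinear {p1, p2, p3, p4}"
  shows "diagonals_cross (p1, p2, p3, p4)"
proof -
  obtain K where K: "convex K" "interior K \<noteq> {}" and fr: "frontier K = closed_segment p1 p2 \<union>
      closed_segment p2 p3 \<union> closed_segment p3 p4 \<union> closed_segment p4 p1"
    using conv by (auto simp: convex_config_def)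
  have 1: "orient p1 p2 p3 * orient p1 p2 p4 \<ge> 0"
    by (rule edge_supports[OF K]) (use fr ne in auto)
  have 2: "orient p2 p3 p4 * orient p2 p3 p1 \<ge> 0"
    by (rule edge_supports[OF K]) (use fr ne in auto)
  have 3: "orient p3 p4 p1 * orient p3 p4 p2 \<ge> 0"
    by (rule edge_supports[OF K]) (use fr ne in auto)
  have 4: "orient p4 p1 p2 * orient p4 p1 p3 \<ge> 0"
    by (rule edge_supports[OF K]) (use fr ne in auto)
  have rot: "orient p2 p3 p1 = orient p1 p2 p3" "orient p3 p4 p1 = orient p1 p3 p4"
    "orient p3 p4 p2 = orient p2 p3 p4" "orient p4 p1 p2 = orient p1 p2 p4" "orient p4 p1 p3 = orient p1 p3 p4"
    by (simp_all add: orient_coords algebra_simps)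
  have n1: "\<not> (orient p1 p2 p3 = 0 \<and> orient p1 p3 p4 = 0)"
  proof
    assume "orient p1 p2 p3 = 0 \<and> orient p1 p3 p4 = 0"
    then have "orient p1 p3 p2 = 0" "orient p1 p3 p4 = 0"
      by (simp_all add: orient_coords algebra_simps)
    from two_orients_0_imp_collinear[OF ne(5) this] nc show False
      by (simp add: insert_commute)
  qed
  have n2: "\<not> (orient p2 p3 p4 = 0 \<and> orient p1 p2 p4 = 0)"
  proof
    assume "orient p2 p3 p4 = 0 \<and> orient p1 p2 p4 = 0"
    then have "orient p2 p4 p3 = 0" "orient p2 p4 p1 = 0"
      by (simp_all add: orient_coords algebra_simps)
    from two_orients_0_imp_collinear[OF ne(6) this] nc show False
      by (simp add: insert_commute)
  qed
  have "orient p2 p3 p4 * orient p1 p2 p4 \<ge> 0"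
    using 1 2 3 4 n1 unfolding rot by (smt (verit) zero_le_mult_iff)
  moreover have "orient p1 p3 p4 * orient p1 p2 p3 \<ge> 0"
    using 1 2 3 4 n2 unfolding rot by (smt (verit) zero_le_mult_iff)
  ultimately show ?thesis
    by (simp add: diagonals_cross_def)
qed

lemma convex_config_rotate: "convex_config (p1, p2, p3, p4) \<longleftrightarrow> convex_config (p2, p3, p4, p1)"
  unfolding convex_config_def case_prod_conv by (simp only: Un_ac)

lemma diagonals_cross_rotate: "diagonals_cross (p1, p2, p3, p4) \<longleftrightarrow> diagonals_cross (p2, p3, p4, p1)"
proof -
  have "orient p3 p4 p1 = orient p1 p3 p4" "orient p2 p3 p1 = orient p1 p2 p3" "orient p2 p4 p1 = orient p1 p2 p4"
    by (simp_all add: orient_coords algebra_simps)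
  then show ?thesis
    unfolding diagonals_cross_def case_prod_conv by (simp only: mult.commute conj_commute)
qed

text \<open>If three consecutive vertices are aligned, crossing diagonals force the middle one to lie
  between its neighbours, and the polygon bounds the triangle of the other three vertices.\<close>

lemma convex_config_triangle:
  assumes "diagonals_cross (p1, p2, p3, p4)" "orient p1 p2 p3 = 0"
    and "p1 \<noteq> p3" and "\<not> collinear {p1, p2, p3, p4}"
  shows "convex_config (p1, p2, p3, p4)"
proof -
  have "orient p1 p3 p2 = 0"
    using assms(2) by (simp add: orient_coords algebra_simps)
  then obtain s where s: "p2 = p1 + s *\<^sub>R (p3 - p1)"
    using orient_eq_0_iff_on_line[OF assms(3)] by blast
  have ne: "orient p1 p3 p4 \<noteq> 0"
    using two_orients_0_imp_collinear[of p1 p3 p2 p4] assms(3,4) \<open>orient p1 p3 p2 = 0\<close>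
    by (auto simp: insert_commute)
  have "orient p1 p2 p4 = s * orient p1 p3 p4" "orient p2 p3 p4 = (1 - s) * orient p1 p3 p4"
    by (simp_all add: s orient_coords algebra_simps)
  then have "orient p2 p3 p4 * orient p1 p2 p4 = s * (1 - s) * (orient p1 p3 p4)\<^sup>2"
    by (simp add: power2_eq_square)
  then have "s * (1 - s) * (orient p1 p3 p4)\<^sup>2 \<ge> 0"
    using assms(1) by (simp add: diagonals_cross_def)
  then have "s * (1 - s) \<ge> 0"
    using ne by (simp add: zero_le_mult_iff)
  then have "0 \<le> s" "s \<le> 1"
    by (auto simp: zero_le_mult_iff)
  then have mem: "p2 \<in> closed_segment p1 p3"
    unfolding in_segment s by (intro exI[of _ s]) (simp add: algebra_simps)
  let ?K = "convex hull {p1, p3, p4}"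
  have "frontier ?K = closed_segment p1 p3 \<union> closed_segment p3 p4 \<union> closed_segment p4 p1"
    by (rule frontier_of_triangle) simp
  then have "frontier ?K = closed_segment p1 p2 \<union> closed_segment p2 p3 \<union> closed_segment p3 p4 \<union> closed_segment p4 p1"
    using Un_closed_segment[OF mem] by simp
  moreover have "interior ?K \<noteq> {}"
  proof -
    have "\<not> collinear {p1, p3, p4}"
    proof
      assume "collinear {p1, p3, p4}"
      then have "collinear {p1, p4, p3}" by (simp add: insert_commute)
      then obtain u where "p4 = u *\<^sub>R p1 + (1 - u) *\<^sub>R p3"
        using assms(3) by (auto simp: collinear_3_expand)
      then have "p4 = p3 + u *\<^sub>R (p1 - p3)" by (simp add: algebra_simps)
      then have "orient p1 p3 p4 = 0" by (simp only: orient_coords) (simp add: algebra_simps)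
      with ne show False by simp
    qed
    then have "\<not> affine_dependent {p1, p3, p4}" and "card {p1, p3, p4} = 3"
      by (auto dest: affine_dependent_imp_collinear_3 simp: card_insert_if insert_commute)
    then show ?thesis
      using interior_convex_hull_eq_empty[of "{p1, p3, p4}"] by simp
  qed
  ultimately show ?thesis
    unfolding convex_config_def by (auto intro!: exI[of _ ?K])
qed

text \<open>On the line \<open>p1p2\<close>, the orientations against the two adjacent edges are affine in the
  position and change sign at \<open>p2\<close> and at \<open>p1\<close>.\<close>

lemma edge_of_halfplanes:
  assumes "\<sigma> * orient p1 p2 p3 > 0" "\<sigma> * orient p4 p1 p2 > 0"
    and "\<sigma> * orient p2 p3 x \<ge> 0" "\<sigma> * orient p4 p1 x \<ge> 0" "orient p1 p2 x = 0" "p1 \<noteq> p2"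
  shows "x \<in> closed_segment p1 p2"
proof -
  obtain s where s: "x = p1 + s *\<^sub>R (p2 - p1)"
    using orient_eq_0_iff_on_line[OF assms(6)] assms(5) by blast
  have "\<sigma> * orient p2 p3 x = (1 - s) * (\<sigma> * orient p1 p2 p3)" "\<sigma> * orient p4 p1 x = s * (\<sigma> * orient p4 p1 p2)"
    by (simp_all add: s orient_coords algebra_simps)
  moreover have "0 \<le> k" if "0 \<le> k * c" "0 < c" for k c :: real
    using that by (auto simp: zero_le_mult_iff)
  ultimately have "0 \<le> s" "0 \<le> 1 - s"
    using assms(1-4) by metis+
  then show ?thesis
    unfolding in_segment s by (intro exI[of _ s]) (use \<open>0 \<le> 1 - s\<close> in \<open>simp add: algebra_simps\<close>)
qed

text \<open>The convex region is the intersection of the four half-planes defined by the edges; its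
  boundary consists of the points at which one of the four inequalities is an equality.
  The factor \<open>\<sigma>\<close> covers both orientations of the polygon.\<close>

lemma convex_config_strict:
  assumes 1: "\<sigma> * orient p1 p2 p3 > 0" and 2: "\<sigma> * orient p2 p3 p4 > 0"
    and 3: "\<sigma> * orient p3 p4 p1 > 0" and 4: "\<sigma> * orient p4 p1 p2 > 0"
  shows "convex_config (p1, p2, p3, p4)"
proof -
  define H where "H p q = {x. (\<sigma> *\<^sub>R rot90 (q - p)) \<bullet> x \<ge> (\<sigma> *\<^sub>R rot90 (q - p)) \<bullet> p}" for p q
  have memH: "x \<in> H p q \<longleftrightarrow> \<sigma> * orient p q x \<ge> 0" for x p q
    by (simp add: H_def orient_def inner_diff_right algebra_simps)
  have ne: "p1 \<noteq> p2" "p2 \<noteq> p3" "p3 \<noteq> p4" "p4 \<noteq> p1" "\<sigma> \<noteq> 0"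
    using assms by (auto simp: orient_coords)
  have intH: "x \<in> interior (H p q) \<longleftrightarrow> \<sigma> * orient p q x > 0" if "p \<noteq> q" for x p q
  proof -
    have "\<sigma> *\<^sub>R rot90 (q - p) \<noteq> 0"
      using that ne by simp
    then have "interior (H p q) = {x. (\<sigma> *\<^sub>R rot90 (q - p)) \<bullet> x > (\<sigma> *\<^sub>R rot90 (q - p)) \<bullet> p}"
      unfolding H_def by (rule interior_halfspace_ge)
    then show ?thesis
      by (simp add: orient_def inner_diff_right algebra_simps)
  qed
  have r: "orient p1 p2 p4 = orient p4 p1 p2" "orient p2 p3 p1 = orient p1 p2 p3" "orient p3 p4 p2 = orient p2 p3 p4"
    "orient p4 p1 p3 = orient p3 p4 p1"
    by (simp_all add: orient_coords algebra_simps)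
  have z: "orient p q q = 0" "orient p q p = 0" for p q
    by (simp_all add: orient_coords)
  define K where "K = H p1 p2 \<inter> H p2 p3 \<inter> H p3 p4 \<inter> H p4 p1"
  have conv: "convex K"
    unfolding K_def H_def by (intro convex_Int convex_halfspace_ge)
  have clo: "closed K"
    unfolding K_def H_def by (intro closed_Int closed_halfspace_ge)
  have intK: "x \<in> interior K \<longleftrightarrow> \<sigma> * orient p1 p2 x > 0 \<and> \<sigma> * orient p2 p3 x > 0
      \<and> \<sigma> * orient p3 p4 x > 0 \<and> \<sigma> * orient p4 p1 x > 0" for x
    unfolding K_def using ne by (simp add: intH)
  have "(1/4) *\<^sub>R (p1 + p2 + p3 + p4) \<in> interior K"
  proof -
    have c: "orient p q ((1/4) *\<^sub>R (p1 + p2 + p3 + p4))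
        = (1/4) * (orient p q p1 + orient p q p2 + orient p q p3 + orient p q p4)" for p q
      by (simp add: orient_coords field_simps)
    show ?thesis
      unfolding intK c using assms by (simp add: z r distrib_left)
  qed
  moreover have "frontier K = closed_segment p1 p2 \<union> closed_segment p2 p3 \<union> closed_segment p3 p4 \<union> closed_segment p4 p1"
    (is "_ = ?R")
  proof
    show "frontier K \<subseteq> ?R"
    proof
      fix x assume "x \<in> frontier K"
      then have x: "x \<in> K" "x \<notin> interior K"
        using clo by (auto simp: frontier_def)
      then have pos: "\<sigma> * orient p1 p2 x \<ge> 0" "\<sigma> * orient p2 p3 x \<ge> 0" "\<sigma> * orient p3 p4 x \<ge> 0" "\<sigma> * orient p4 p1 x \<ge> 0"
        by (auto simp: K_def memH)
      have "\<sigma> * orient p1 p2 x = 0 \<or> \<sigma> * orient p2 p3 x = 0 \<or> \<sigma> * orient p3 p4 x = 0 \<or> \<sigma> * orient p4 p1 x = 0"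
        using x(2) pos unfolding intK by (auto simp: less_le)
      then have "orient p1 p2 x = 0 \<or> orient p2 p3 x = 0 \<or> orient p3 p4 x = 0 \<or> orient p4 p1 x = 0"
        using ne by simp
      then show "x \<in> ?R"
        using edge_of_halfplanes[of \<sigma> p1 p2 p3 p4 x] edge_of_halfplanes[of \<sigma> p2 p3 p4 p1 x]
          edge_of_halfplanes[of \<sigma> p3 p4 p1 p2 x] edge_of_halfplanes[of \<sigma> p4 p1 p2 p3 x]
          assms pos ne by auto
    qed
    have vert: "p1 \<in> K" "p2 \<in> K" "p3 \<in> K" "p4 \<in> K"
      using assms by (simp_all add: K_def memH z r)
    have "x \<in> frontier K" if seg: "x \<in> closed_segment p q" and "p \<in> K" "q \<in> K"
      "(p, q) \<in> {(p1, p2), (p2, p3), (p3, p4), (p4, p1)}" for x p q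
    proof -
      have "x \<in> K"
        using that conv by (meson closed_segment_subset subsetD)
      moreover have "orient p q x = 0"
      proof -
        obtain u where "x = (1 - u) *\<^sub>R p + u *\<^sub>R q"
          using seg unfolding in_segment by blast
        then have "x = p + u *\<^sub>R (q - p)"
          by (simp add: algebra_simps)
        then show ?thesis
          by (simp add: orient_coords)
      qed
      then have "x \<notin> interior K"
        using that(4) unfolding intK by auto
      ultimately show ?thesis
        using clo by (simp add: frontier_def)
    qed
    then show "?R \<subseteq> frontier K"
      using vert by blast
  qed
  ultimately show ?thesis
    unfolding convex_config_def using conv by blast
qed

lemma diagonals_cross_imp_convex_config:
  assumes cr: "diagonals_cross (p1, p2, p3, p4)"
    and ne: "p1 \<noteq> p3" "p2 \<noteq> p4" and nc: "\<not> collinear {p1, p2, p3, p4}"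
  shows "convex_config (p1, p2, p3, p4)"
proof -
  have r: "orient p3 p4 p1 = orient p1 p3 p4" "orient p4 p1 p2 = orient p1 p2 p4"
    by (simp_all only: orient_rotate[of p3 p4 p1] orient_rotate[of p4 p1 p2] orient_rotate[of p2 p4 p1])
  have c2: "diagonals_cross (p2, p3, p4, p1)" and c3: "diagonals_cross (p3, p4, p1, p2)"
    and c4: "diagonals_cross (p4, p1, p2, p3)"
    using cr diagonals_cross_rotate[of p1 p2 p3 p4] diagonals_cross_rotate[of p2 p3 p4 p1]
      diagonals_cross_rotate[of p3 p4 p1 p2] by simp_all
  have n2: "\<not> collinear {p2, p3, p4, p1}" and n3: "\<not> collinear {p3, p4, p1, p2}" and n4: "\<not> collinear {p4, p1, p2, p3}"
    using nc by (simp_all add: insert_commute)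
  consider "orient p1 p2 p3 = 0" | "orient p2 p3 p4 = 0" | "orient p3 p4 p1 = 0" | "orient p4 p1 p2 = 0"
    | "orient p1 p2 p3 \<noteq> 0" "orient p2 p3 p4 \<noteq> 0" "orient p3 p4 p1 \<noteq> 0" "orient p4 p1 p2 \<noteq> 0"
    by blast
  then show ?thesis
  proof cases
    case 1 with cr ne nc show ?thesis by (simp add: convex_config_triangle)
  next
    case 2 with c2 ne n2 have "convex_config (p2, p3, p4, p1)" by (intro convex_config_triangle) auto
    then show ?thesis
      using convex_config_rotate[of p1 p2 p3 p4] convex_config_rotate[of p2 p3 p4 p1]
        convex_config_rotate[of p3 p4 p1 p2] by simp
  next
    case 3 with c3 ne n3 have "convex_config (p3, p4, p1, p2)" by (intro convex_config_triangle) auto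
    then show ?thesis
      using convex_config_rotate[of p1 p2 p3 p4] convex_config_rotate[of p2 p3 p4 p1]
        convex_config_rotate[of p3 p4 p1 p2] by simp
  next
    case 4 with c4 ne n4 have "convex_config (p4, p1, p2, p3)" by (intro convex_config_triangle) auto
    then show ?thesis
      using convex_config_rotate[of p1 p2 p3 p4] convex_config_rotate[of p2 p3 p4 p1]
        convex_config_rotate[of p3 p4 p1 p2] by simp
  next
    case 5
    let ?A = "orient p2 p3 p4"
    have "?A * orient p4 p1 p2 > 0" "orient p3 p4 p1 * orient p1 p2 p3 > 0"
      using cr 5 by (auto simp: diagonals_cross_def r less_le)
    moreover have "?A + orient p4 p1 p2 = orient p3 p4 p1 + orient p1 p2 p3"
      using orient_sum[of p2 p3 p4 p1] by (simp add: r)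
    ultimately have "?A * orient p1 p2 p3 > 0" "?A * orient p3 p4 p1 > 0" "?A * orient p4 p1 p2 > 0"
      by (smt (verit) zero_less_mult_iff)+
    then show ?thesis
      using 5 by (intro convex_config_strict[of ?A]) (auto simp: zero_less_mult_iff)
  qed
qed

section \<open>Non-degenerate linkages\<close>

text \<open>If opposite vertices coincide, the linkage can be folded onto a line.\<close>

lemma nondegenerate_imp_diagonal_nonzero:
  assumes "nondegenerate a b c d" "a > 0" "d > 0"
    and p: "(p1, p2, p3, p4) \<in> configurations a b c d"
  shows "p1 \<noteq> p3"
proof
  assume eq: "p1 = p3"
  let ?e = "axis 1 1 :: plane"
  have "(0, a *\<^sub>R ?e, 0, d *\<^sub>R ?e) \<in> configurations a b c d"
    using p eq assms(2,3) by (auto simp: configurations_def dist_norm dist_commute norm_minus_commute)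
  moreover have "collinear {0, a *\<^sub>R ?e, 0, d *\<^sub>R ?e}"
    unfolding collinear_alt
    by (rule exI[of _ 0], rule exI[of _ ?e]) (auto intro: exI[of _ "0::real"])
  ultimately show False
    using assms(1) by (auto simp: nondegenerate_def)
qed

lemma nondegenerate_rotate: "nondegenerate a b c d \<Longrightarrow> nondegenerate b c d a"
proof -
  assume nd: "nondegenerate a b c d"
  have "\<not> collinear {p1, p2, p3, p4}" if "(p1, p2, p3, p4) \<in> configurations b c d a" for p1 p2 p3 p4
  proof -
    have "(p4, p1, p2, p3) \<in> configurations a b c d"
      using that configurations_rotate by blast
    then have "\<not> collinear {p4, p1, p2, p3}"
      using nd by (auto simp: nondegenerate_def)
    then show ?thesis by (simp add: insert_commute)
  qed
  then show ?thesis by (auto simp: nondegenerate_def)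
qed

section \<open>Congruent configurations\<close>

lemma plane_isometry_inverse:
  assumes "f \<in> plane_isometries"
  obtains g where "g \<in> plane_isometries" "\<And>x. g (f x) = x"
proof -
  define h where "h x = f x - f 0" for x
  have "orthogonal_transformation h"
    using assms by (simp add: orthogonal_transformation_isometry h_def plane_isometries_def dist_norm)
  then have inv: "orthogonal_transformation (inv h)" and inj: "inj h"
    by (simp_all add: orthogonal_transformation_inv orthogonal_transformation_inj)
  let ?g = "\<lambda>y. inv h (y - f 0)"
  have "?g \<in> plane_isometries"
    using inv by (simp add: orthogonal_transformation_isometry plane_isometries_def dist_norm)
  moreover have "?g (f x) = x" for x
    using inv_f_f[OF inj, of x] by (simp add: h_def)
  ultimately show ?thesis by (rule that)
qed

lemma plane_isometries_comp: "f \<in> plane_isometries \<Longrightarrow> g \<in> plane_isometries \<Longrightarrow> (\<lambda>x. f (g x)) \<in> plane_isometries"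
  by (simp add: plane_isometries_def)

lemma config_class_isometry:
  assumes f: "f \<in> plane_isometries"
  shows "config_class (f p1, f p2, f p3, f p4) = config_class (p1, p2, p3, p4)"
proof
  show "config_class (f p1, f p2, f p3, f p4) \<subseteq> config_class (p1, p2, p3, p4)"
    using plane_isometries_comp[OF _ f] by (fastforce simp: config_class_def)
  obtain g where g: "g \<in> plane_isometries" and gf: "\<And>x. g (f x) = x"
    using plane_isometry_inverse[OF f] by metis
  show "config_class (p1, p2, p3, p4) \<subseteq> config_class (f p1, f p2, f p3, f p4)"
  proof
    fix q assume "q \<in> config_class (p1, p2, p3, p4)"
    then obtain k where k: "k \<in> plane_isometries" "q = (k p1, k p2, k p3, k p4)"
      by (auto simp: config_class_def)
    have "(\<lambda>x. k (g x)) \<in> plane_isometries"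
      by (rule plane_isometries_comp[OF k(1) g])
    moreover have "q = ((\<lambda>x. k (g x)) (f p1), (\<lambda>x. k (g x)) (f p2), (\<lambda>x. k (g x)) (f p3), (\<lambda>x. k (g x)) (f p4))"
      by (simp add: k gf)
    ultimately show "q \<in> config_class (f p1, f p2, f p3, f p4)"
      unfolding config_class_def case_prod_conv
      by (intro CollectI exI[of _ "\<lambda>x. k (g x)"]) simp
  qed
qed

lemma inner_sq_plus_rot90_sq: "(e \<bullet> u) * (e \<bullet> v) + (rot90 e \<bullet> u) * (rot90 e \<bullet> v) = (e \<bullet> e) * (u \<bullet> v)"
  by (simp add: inner_plane algebra_simps)

lemma inner_via_dist: "2 * ((u - p) \<bullet> (v - p)) = (dist p u)\<^sup>2 + (dist p v)\<^sup>2 - (dist u v)\<^sup>2" for u v p :: plane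
  by (simp only: dist_plane_sq inner_plane) (simp add: power2_eq_square algebra_simps)

text \<open>Place both configurations in the frames of their first diagonals. The distances determine
  the coordinates along the diagonal, the squares of the heights of the second and fourth
  vertices over it, and the product of the two heights. So the heights agree up to one
  common sign, which is realised by a rotation or by a reflection.\<close>

lemma config_class_eqI:
  assumes d: "dist p1 p2 = dist q1 q2" "dist p2 p3 = dist q2 q3" "dist p3 p4 = dist q3 q4"
      "dist p4 p1 = dist q4 q1" "dist p1 p3 = dist q1 q3" "dist p2 p4 = dist q2 q4"
    and "p1 \<noteq> p3"
  shows "config_class (p1, p2, p3, p4) = config_class (q1, q2, q3, q4)"
proof -
  define e e' where "e = p3 - p1" and "e' = q3 - q1"
  have i: "e \<bullet> (p2 - p1) = e' \<bullet> (q2 - q1)" "e \<bullet> (p4 - p1) = e' \<bullet> (q4 - q1)"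
    "(p2 - p1) \<bullet> (p4 - p1) = (q2 - q1) \<bullet> (q4 - q1)" "e \<bullet> e = e' \<bullet> e'"
    "(p2 - p1) \<bullet> (p2 - p1) = (q2 - q1) \<bullet> (q2 - q1)" "(p4 - p1) \<bullet> (p4 - p1) = (q4 - q1) \<bullet> (q4 - q1)"
    using inner_via_dist[of p3 p1 p2] inner_via_dist[of q3 q1 q2] inner_via_dist[of p3 p1 p4]
      inner_via_dist[of q3 q1 q4] inner_via_dist[of p2 p1 p4] inner_via_dist[of q2 q1 q4]
      inner_via_dist[of p3 p1 p3] inner_via_dist[of q3 q1 q3] inner_via_dist[of p2 p1 p2] inner_via_dist[of q2 q1 q2]
      inner_via_dist[of p4 p1 p4] inner_via_dist[of q4 q1 q4] d
    by (simp_all add: e_def e'_def dist_commute)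
  define B2 B4 B2' B4' where B: "B2 = rot90 e \<bullet> (p2 - p1)" "B4 = rot90 e \<bullet> (p4 - p1)"
    "B2' = rot90 e' \<bullet> (q2 - q1)" "B4' = rot90 e' \<bullet> (q4 - q1)"
  have "e \<noteq> 0" using assms(7) by (simp add: e_def)
  then have N: "e \<bullet> e \<noteq> 0" and "e' \<noteq> 0" using i(4) by auto
  have sq: "B2 * B2 = B2' * B2'" "B4 * B4 = B4' * B4'" "B2 * B4 = B2' * B4'"
    using inner_sq_plus_rot90_sq[of e "p2 - p1" "p2 - p1"] inner_sq_plus_rot90_sq[of e' "q2 - q1" "q2 - q1"]
      inner_sq_plus_rot90_sq[of e "p4 - p1" "p4 - p1"] inner_sq_plus_rot90_sq[of e' "q4 - q1" "q4 - q1"]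
      inner_sq_plus_rot90_sq[of e "p2 - p1" "p4 - p1"] inner_sq_plus_rot90_sq[of e' "q2 - q1" "q4 - q1"]
    unfolding B i by linarith+
  obtain \<sigma> :: real where \<sigma>: "\<sigma> * \<sigma> = 1" "B2' = \<sigma> * B2" "B4' = \<sigma> * B4"
  proof (cases "B2' = B2 \<and> B4' = B4")
    case True then show ?thesis using that[of 1] by simp
  next
    case False
    have "B2' = B2 \<or> B2' = - B2" "B4' = B4 \<or> B4' = - B4"
      using sq(1,2) by (metis square_eq_iff)+
    with False sq(3) have "B2' = - B2 \<and> B4' = - B4" by auto
    then show ?thesis using that[of "-1"] by simp
  qed
  define f where "f z = q1 + ((e \<bullet> (z - p1)) / (e \<bullet> e)) *\<^sub>R e' + (\<sigma> * (rot90 e \<bullet> (z - p1)) / (e \<bullet> e)) *\<^sub>R rot90 e'" for z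
  have "dist (f u) (f v) = dist u v" for u v
  proof -
    define x y where "x = (e \<bullet> (u - v)) / (e \<bullet> e)" and "y = (rot90 e \<bullet> (u - v)) / (e \<bullet> e)"
    have rr: "rot90 e' \<bullet> rot90 e' = e \<bullet> e" "e' \<bullet> rot90 e' = 0" "rot90 e' \<bullet> e' = 0"
      unfolding i(4) by (simp_all add: inner_plane)
    have "f u - f v = x *\<^sub>R e' + (\<sigma> * y) *\<^sub>R rot90 e'"
      by (simp add: f_def x_def y_def inner_diff_right diff_divide_distrib right_diff_distrib scaleR_diff_left)
    then have "(dist (f u) (f v))\<^sup>2 = (x * x + (\<sigma> * \<sigma>) * (y * y)) * (e \<bullet> e)"
      by (simp add: dist_norm power2_norm_eq_inner inner_add_left inner_add_right rr i(4)[symmetric] algebra_simps)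
    also have "\<dots> = ((e \<bullet> (u - v)) * (e \<bullet> (u - v)) + (rot90 e \<bullet> (u - v)) * (rot90 e \<bullet> (u - v))) / (e \<bullet> e)"
      using N by (simp add: \<sigma>(1) x_def y_def add_divide_distrib distrib_right)
    also have "\<dots> = (u - v) \<bullet> (u - v)"
      unfolding inner_sq_plus_rot90_sq using N by simp
    also have "\<dots> = (dist u v)\<^sup>2"
      by (simp add: dist_norm power2_norm_eq_inner)
    finally show ?thesis by simp
  qed
  then have iso: "f \<in> plane_isometries"
    by (simp add: plane_isometries_def)
  have dec: "q1 + ((e' \<bullet> z) / (e \<bullet> e)) *\<^sub>R e' + ((rot90 e' \<bullet> z) / (e \<bullet> e)) *\<^sub>R rot90 e' = q1 + z" for z
    using plane_decomp[OF \<open>e' \<noteq> 0\<close>, of z, symmetric] by (simp add: i(4) add.assoc)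
  have "f p1 = q1" by (simp add: f_def)
  moreover have "f p2 = q2"
    using dec[of "q2 - q1"] \<sigma>(2) by (simp add: f_def i B)
  moreover have "f p4 = q4"
    using dec[of "q4 - q1"] \<sigma>(3) by (simp add: f_def i B)
  moreover have "f p3 = q3"
  proof -
    have "rot90 e \<bullet> e = 0" by (simp add: inner_plane)
    then have "f p3 = q1 + e'" using N by (simp add: f_def e_def[symmetric])
    then show ?thesis by (simp add: e'_def)
  qed
  ultimately show ?thesis
    using config_class_isometry[OF iso, of p1 p2 p3 p4] by simp
qed

section \<open>Reflecting a vertex in a diagonal\<close>

text \<open>The witness is the mirror image of \<open>r\<close> in the line \<open>pq\<close>. It moves away from the
  points on the side of \<open>r\<close>, stays at the same distance from the points of the line, and
  moves closer to the others.\<close>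

lemma reflect_in_line:
  assumes "p \<noteq> q"
  shows "\<exists>r'. \<forall>x. (dist r' x)\<^sup>2 = (dist r x)\<^sup>2 + 4 * orient p q r * orient p q x / (dist p q)\<^sup>2"
proof -
  define n where "n = rot90 (q - p)"
  define k where "k = orient p q r / (dist p q)\<^sup>2"
  have N: "n \<bullet> n = (dist p q)\<^sup>2" "n \<bullet> n \<noteq> 0"
    using assms by (simp_all add: n_def dist_plane_sq) (simp add: inner_plane power2_eq_square algebra_simps)
  have "(dist (r - (2 * k) *\<^sub>R n) x)\<^sup>2 = (dist r x)\<^sup>2 + 4 * orient p q r * orient p q x / (dist p q)\<^sup>2" for x
  proof -
    have "(dist (r - (2 * k) *\<^sub>R n) x)\<^sup>2 = (dist r x)\<^sup>2 - 4 * k * (n \<bullet> (r - x)) + 4 * k * (k * (n \<bullet> n))"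
      unfolding dist_plane_sq inner_plane by (simp add: power2_eq_square algebra_simps)
    also have "k * (n \<bullet> n) = orient p q r"
      using N by (simp add: k_def)
    also have "n \<bullet> (r - x) = orient p q r - orient p q x"
      by (simp add: orient_def n_def inner_diff_right)
    finally show ?thesis
      by (simp add: k_def right_diff_distrib)
  qed
  then show ?thesis by blast
qed

text \<open>If \<open>p2\<close> and \<open>p4\<close> lay strictly on the same side of the line \<open>p1p3\<close>, reflecting \<open>p2\<close> in
  it would keep the sides and the first diagonal and lengthen the second one.\<close>

lemma opposite_sides_if_diagonal_maximal:
  assumes p: "(p1, p2, p3, p4) \<in> configurations a b c d" and "p1 \<noteq> p3"
    and max: "\<And>q1 q2 q3 q4. (q1, q2, q3, q4) \<in> configurations a b c d \<Longrightarrow> dist q1 q3 = dist p1 p3 \<Longrightarrow> dist q2 q4 \<le> dist p2 p4"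
  shows "orient p1 p3 p4 * orient p1 p2 p3 \<ge> 0"
proof (rule ccontr)
  assume neg: "\<not> ?thesis"
  have sw: "orient p1 p3 p2 = - orient p1 p2 p3"
    by (simp add: orient_coords algebra_simps)
  obtain r where r: "\<And>x. (dist r x)\<^sup>2 = (dist p2 x)\<^sup>2 + 4 * orient p1 p3 p2 * orient p1 p3 x / (dist p1 p3)\<^sup>2"
    using reflect_in_line[OF \<open>p1 \<noteq> p3\<close>, of p2] by blast
  have "orient p1 p3 p1 = 0" "orient p1 p3 p3 = 0"
    by (simp_all add: orient_coords)
  then have "dist r p1 = dist p2 p1" "dist r p3 = dist p2 p3"
    using r[of p1] r[of p3] by simp_all
  then have "(p1, r, p3, p4) \<in> configurations a b c d"
    using p by (auto simp: configurations_def dist_commute)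
  then have "dist r p4 \<le> dist p2 p4" using max by blast
  then have "(dist r p4)\<^sup>2 \<le> (dist p2 p4)\<^sup>2" by (simp add: power_mono)
  moreover have "4 * orient p1 p3 p2 * orient p1 p3 p4 / (dist p1 p3)\<^sup>2 > 0"
    using neg \<open>p1 \<noteq> p3\<close> by (intro divide_pos_pos) (simp_all add: sw mult.commute)
  ultimately show False using r[of p4] by simp
qed

section \<open>A compact set of representatives\<close>

text \<open>Fixing one vertex removes the translations, and with them the non-compactness.\<close>

definition anchored :: "real \<Rightarrow> real \<Rightarrow> real \<Rightarrow> real \<Rightarrow> config set" where
  "anchored a b c d = {p \<in> configurations a b c d. fst p = 0}"

lemma compact_anchored: "compact (anchored a b c d)"
proof -
  have "configurations a b c d = {p. dist (fst p) (fst (snd p)) = a \<and> dist (fst (snd p)) (fst (snd (snd p))) = b \<and>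
      dist (fst (snd (snd p))) (snd (snd (snd p))) = c \<and> dist (snd (snd (snd p))) (fst p) = d}"
    by (auto simp: configurations_def)
  also have "closed \<dots>"
    by (intro closed_Collect_conj closed_Collect_eq continuous_intros)
  finally have "closed (configurations a b c d)" .
  moreover have "compact ({0::plane} \<times> cball (0::plane) a \<times> cball (0::plane) (a + b) \<times> cball (0::plane) d)"
    by (intro compact_Times) auto
  ultimately have "compact (configurations a b c d \<inter> ({0} \<times> cball 0 a \<times> cball 0 (a + b) \<times> cball 0 d))"
    by (rule closed_Int_compact)
  moreover have "anchored a b c d = configurations a b c d \<inter> ({0} \<times> cball 0 a \<times> cball 0 (a + b) \<times> cball 0 d)"
  proof -
    have "norm p3 \<le> norm p2 + dist p2 p3" for p2 p3 :: plane
      by (metis dist_0_norm dist_triangle)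
    then show ?thesis
      by (fastforce simp: anchored_def configurations_def)
  qed
  ultimately show ?thesis by simp
qed

lemma anchored_representative:
  assumes "p \<in> configurations a b c d"
  shows "\<exists>q \<in> anchored a b c d. config_class q = config_class p"
proof -
  obtain p1 p2 p3 p4 where p: "p = (p1, p2, p3, p4)" by (cases p)
  have iso: "(\<lambda>x. x - p1) \<in> plane_isometries"
    by (simp add: plane_isometries_def dist_norm)
  have "(p1 - p1, p2 - p1, p3 - p1, p4 - p1) \<in> anchored a b c d"
    using assms by (auto simp: p anchored_def configurations_def dist_norm norm_minus_commute)
  then show ?thesis
    using config_class_isometry[OF iso, of p1 p2 p3 p4] p by blast
qed

section \<open>Smooth motions that change a diagonal\<close>

lemma C1_differentiable_on_Pair:
  assumes "f C1_differentiable_on S" "g C1_differentiable_on S"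
  shows "(\<lambda>s. (f s, g s)) C1_differentiable_on S"
proof -
  obtain F G where "\<forall>x\<in>S. (f has_vector_derivative F x) (at x)" "continuous_on S F"
      "\<forall>x\<in>S. (g has_vector_derivative G x) (at x)" "continuous_on S G"
    using assms by (auto simp: C1_differentiable_on_def)
  then show ?thesis
    unfolding C1_differentiable_on_def
    by (intro exI[of _ "\<lambda>s. (F s, G s)"]) (auto intro: has_vector_derivative_Pair continuous_intros)
qed

lemma C1_differentiable_on_sqrt:
  assumes "f C1_differentiable_on S" and pos: "\<And>s. s \<in> S \<Longrightarrow> f s > 0"
  shows "(\<lambda>s. sqrt (f s)) C1_differentiable_on S"
proof -
  obtain F where F: "\<forall>x\<in>S. (f has_vector_derivative F x) (at x)" "continuous_on S F"
    using assms by (auto simp: C1_differentiable_on_def)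
  have cont: "continuous_on S f"
  proof (intro continuous_at_imp_continuous_on ballI)
    fix x assume "x \<in> S"
    with F(1) have "(f has_vector_derivative F x) (at x)" by blast
    then show "isCont f x" by (rule has_vector_derivative_continuous)
  qed
  have ne: "sqrt (f x) \<noteq> 0" if "x \<in> S" for x
    using pos[OF that] by simp
  have "((\<lambda>s. sqrt (f s)) has_vector_derivative F x * (inverse (sqrt (f x)) / 2)) (at x)" if "x \<in> S" for x
  proof -
    have "(f has_real_derivative F x) (at x)"
      using F(1) that by (simp add: has_real_derivative_iff_has_vector_derivative)
    then have "((\<lambda>s. sqrt (f s)) has_real_derivative inverse (sqrt (f x)) / 2 * F x) (at x)"
      by (rule DERIV_chain2[where f = sqrt and g = f, OF DERIV_real_sqrt[OF pos[OF that]]])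
    then show ?thesis
      by (simp add: has_real_derivative_iff_has_vector_derivative mult.commute)
  qed
  moreover have "continuous_on S (\<lambda>x. F x * (inverse (sqrt (f x)) / 2))"
    using ne by (intro continuous_on_mult continuous_on_divide continuous_on_inverse
        continuous_on_real_sqrt continuous_on_const F(2) cont) auto
  ultimately show ?thesis
    unfolding C1_differentiable_on_def
    by (intro exI[of _ "\<lambda>x. F x * (inverse (sqrt (f x)) / 2)"] conjI ballI)
qed

lemma C1_differentiable_on_inverse_affine:
  fixes S :: "real set"
  assumes "\<And>s. s \<in> S \<Longrightarrow> 1 + s \<noteq> 0"
  shows "(\<lambda>s. inverse (1 + s)) C1_differentiable_on S"
  unfolding C1_differentiable_on_def
proof (intro exI conjI ballI)
  fix x assume "x \<in> S"
  then show "((\<lambda>s. inverse (1 + s)) has_vector_derivative - (inverse (1 + x) * inverse (1 + x))) (at x)"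
    unfolding has_real_derivative_iff_has_vector_derivative[symmetric]
    using assms by (auto intro!: derivative_eq_intros)
next
  show "continuous_on S (\<lambda>x. - (inverse (1 + x) * inverse (1 + x)))"
    using assms by (intro continuous_intros) auto
qed

text \<open>The apex of a non-flat triangle follows smoothly when one base vertex slides along the base
  line: in the frame of the base its coordinates are \<open>A\<close> and a square root of \<open>G\<close>, where \<open>G\<close>
  is positive at the start and hence nearby.\<close>

lemma hinge_motion:
  fixes p q r :: plane
  assumes "orient p q r \<noteq> 0"
  shows "\<exists>\<rho> \<epsilon>. \<epsilon> > 0 \<and> \<rho> C1_differentiable_on {-\<epsilon><..<\<epsilon>} \<and> \<rho> 0 = r \<and>
    (\<forall>s \<in> {-\<epsilon><..<\<epsilon>}. dist p (\<rho> s) = dist p r \<and> dist (p + (1 + s) *\<^sub>R (q - p)) (\<rho> s) = dist q r)"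
proof -
  define e where "e = q - p"
  define N where "N = e \<bullet> e"
  have "p \<noteq> q" using assms by (auto simp: orient_coords)
  then have N: "N > 0" by (simp add: N_def e_def)
  define l where "l = (dist p r)\<^sup>2"
  define m where "m = (dist q r)\<^sup>2"
  define k where "k = (l - m) / N"
  define A where "A s = (1/2) * (k * inverse (1 + s) + (1 + s))" for s
  define G where "G s = l / N - A s * A s" for s
  define \<sigma> where "\<sigma> = sgn (orient p q r)"
  have \<sigma>: "\<sigma> * \<sigma> = 1" using assms by (simp add: \<sigma>_def sgn_if)
  have A0: "A 0 = (e \<bullet> (r - p)) / N"
  proof -
    have "2 * (e \<bullet> (r - p)) = N + l - m"
      unfolding N_def e_def l_def m_def
      by (simp only: dist_plane_sq inner_plane) (simp add: power2_eq_square algebra_simps)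
    then have "e \<bullet> (r - p) = (N + l - m) / 2" by simp
    then show ?thesis using N by (simp add: A_def k_def add_divide_distrib diff_divide_distrib)
  qed
  have lz: "l = (r - p) \<bullet> (r - p)"
    by (simp only: l_def dist_plane_sq inner_plane) (simp add: power2_eq_square algebra_simps)
  have G0: "G 0 = (orient p q r / N)\<^sup>2"
  proof -
    have "N * l = (e \<bullet> (r - p))\<^sup>2 + (orient p q r)\<^sup>2"
      unfolding N_def lz orient_def e_def[symmetric]
      by (simp add: inner_plane power2_eq_square algebra_simps)
    then have "l / N = ((e \<bullet> (r - p))\<^sup>2 + (orient p q r)\<^sup>2) / N\<^sup>2"
      using N by (simp add: field_simps power2_eq_square)
    then show ?thesis
      by (simp add: G_def A0 power2_eq_square add_divide_distrib)
  qed
  have "isCont G 0"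
    unfolding G_def A_def by (intro continuous_intros) auto
  moreover have "G 0 > 0" using assms N by (simp add: G0)
  ultimately have "\<forall>\<^sub>F s in at 0. G s > 0"
    by (simp add: isCont_def order_tendstoD(1))
  then obtain \<delta> where \<delta>: "\<delta> > 0" "\<And>s. s \<noteq> 0 \<Longrightarrow> dist s 0 < \<delta> \<Longrightarrow> G s > 0"
    by (auto simp: eventually_at)
  define \<epsilon> where "\<epsilon> = min \<delta> (1/2)"
  let ?I = "{-\<epsilon><..<\<epsilon>}"
  have pos: "G s > 0" "1 + s > 0" if "s \<in> ?I" for s
    using \<delta>(2)[of s] that \<open>G 0 > 0\<close> by (cases "s = 0"; auto simp: \<epsilon>_def dist_real_def)+
  have AC: "A C1_differentiable_on ?I"
    unfolding A_def using pos(2)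
    by (intro C1_differentiable_on_mult C1_differentiable_on_add C1_differentiable_on_const
        C1_differentiable_on_ident C1_differentiable_on_inverse_affine) (auto simp: less_imp_neq[symmetric])
  define \<rho> where "\<rho> s = p + (A s *\<^sub>R e + (\<sigma> * sqrt (G s)) *\<^sub>R rot90 e)" for s
  have "(\<lambda>s. sqrt (G s)) C1_differentiable_on ?I"
    unfolding G_def by (rule C1_differentiable_on_sqrt)
      (use pos(1) in \<open>auto simp: G_def intro!: C1_differentiable_on_diff C1_differentiable_on_mult AC\<close>)
  then have "\<rho> C1_differentiable_on ?I"
    unfolding \<rho>_def
    by (intro C1_differentiable_on_add C1_differentiable_on_scaleR C1_differentiable_on_mult
        C1_differentiable_on_const AC)
  moreover have "\<rho> 0 = r"
  proof -
    have "\<sigma> * sqrt (G 0) = orient p q r / N"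
      using N by (simp add: G0 \<sigma>_def sgn_mult_abs)
    then show ?thesis
      using plane_decomp[of e "r - p"] \<open>p \<noteq> q\<close> unfolding \<rho>_def A0 orient_def e_def[symmetric] N_def[symmetric]
      by (simp add: e_def)
  qed
  moreover have "dist p (\<rho> s) = dist p r \<and> dist (p + (1 + s) *\<^sub>R (q - p)) (\<rho> s) = dist q r" if s: "s \<in> ?I" for s
  proof -
    have sq: "(\<sigma> * sqrt (G s)) * (\<sigma> * sqrt (G s)) = G s"
      using pos(1)[OF s] \<sigma> by (simp add: algebra_simps)
    have gen: "(dist (p + x *\<^sub>R e) (p + (y *\<^sub>R e + z *\<^sub>R rot90 e)))\<^sup>2 = ((x - y) * (x - y) + z * z) * N" for x y z
      unfolding dist_plane_sq N_def inner_plane by (simp add: power2_eq_square algebra_simps)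
    have "(dist p (\<rho> s))\<^sup>2 = (A s * A s + G s) * N"
      using gen[of 0 "A s" "\<sigma> * sqrt (G s)"] unfolding sq by (simp add: \<rho>_def)
    then have 1: "(dist p (\<rho> s))\<^sup>2 = l"
      using N by (simp add: G_def)
    have "(dist (p + (1 + s) *\<^sub>R e) (\<rho> s))\<^sup>2 = ((1 + s - A s) * (1 + s - A s) + G s) * N"
      using gen[of "1 + s" "A s" "\<sigma> * sqrt (G s)"] unfolding sq by (simp add: \<rho>_def)
    also have "\<dots> = ((1 + s) * (1 + s) - 2 * (1 + s) * A s) * N + l"
      using N by (simp add: G_def algebra_simps)
    also have "2 * (1 + s) * A s = k + (1 + s) * (1 + s)"
      using pos(2)[OF s] by (simp add: A_def field_simps)
    finally have 2: "(dist (p + (1 + s) *\<^sub>R e) (\<rho> s))\<^sup>2 = m"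
      using N by (simp add: k_def)
    show ?thesis
      using 1 2 by (simp add: l_def m_def e_def)
  qed
  moreover have "\<epsilon> > 0" using \<delta>(1) by (auto simp: \<epsilon>_def)
  ultimately show ?thesis by (intro exI[of _ \<rho>] exI[of _ \<epsilon>]) auto
qed

text \<open>The diagonal \<open>p1p3\<close> can be stretched with non-zero speed, the vertices \<open>p2\<close> and \<open>p4\<close>
  following as apexes of two hinges. A flat hinge would be at the end of its range, where the
  square root is not smooth.\<close>

lemma diagonal_motion:
  assumes p: "(p1, p2, p3, p4) \<in> configurations a b c d"
    and "orient p1 p2 p3 \<noteq> 0" "orient p1 p3 p4 \<noteq> 0"
  shows "\<exists>g1 g2 g3 g4 \<epsilon> u'. \<epsilon> > 0 \<and>
    g1 C1_differentiable_on {-\<epsilon><..<\<epsilon>} \<and> g2 C1_differentiable_on {-\<epsilon><..<\<epsilon>} \<and>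
    g3 C1_differentiable_on {-\<epsilon><..<\<epsilon>} \<and> g4 C1_differentiable_on {-\<epsilon><..<\<epsilon>} \<and>
    (\<forall>s \<in> {-\<epsilon><..<\<epsilon>}. (g1 s, g2 s, g3 s, g4 s) \<in> configurations a b c d) \<and>
    (g1 0, g2 0, g3 0, g4 0) = (p1, p2, p3, p4) \<and>
    ((\<lambda>s. (dist (g1 s) (g3 s))\<^sup>2) has_real_derivative u') (at 0) \<and> u' \<noteq> 0"
proof -
  have "orient p1 p3 p2 \<noteq> 0"
    using assms(2) by (auto simp: orient_coords algebra_simps)
  from hinge_motion[OF this] obtain \<rho> \<epsilon> where
    \<rho>: "\<epsilon> > 0" "\<rho> C1_differentiable_on {-\<epsilon><..<\<epsilon>}" "\<rho> 0 = p2"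
    "\<forall>s \<in> {-\<epsilon><..<\<epsilon>}. dist p1 (\<rho> s) = dist p1 p2 \<and> dist (p1 + (1 + s) *\<^sub>R (p3 - p1)) (\<rho> s) = dist p3 p2"
    by (elim exE conjE)
  from hinge_motion[OF assms(3)] obtain \<rho>' \<epsilon>' where
    \<rho>': "\<epsilon>' > 0" "\<rho>' C1_differentiable_on {-\<epsilon>'<..<\<epsilon>'}" "\<rho>' 0 = p4"
    "\<forall>s \<in> {-\<epsilon>'<..<\<epsilon>'}. dist p1 (\<rho>' s) = dist p1 p4 \<and> dist (p1 + (1 + s) *\<^sub>R (p3 - p1)) (\<rho>' s) = dist p3 p4"
    by (elim exE conjE)
  define \<delta> where "\<delta> = min \<epsilon> \<epsilon>'"
  have I: "{-\<delta><..<\<delta>} \<subseteq> {-\<epsilon><..<\<epsilon>}" "{-\<delta><..<\<delta>} \<subseteq> {-\<epsilon>'<..<\<epsilon>'}"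
    by (auto simp: \<delta>_def)
  let ?g = "\<lambda>s. p1 + (1 + s) *\<^sub>R (p3 - p1)"
  show ?thesis
  proof (rule exI[of _ "\<lambda>s. p1"], rule exI[of _ \<rho>], rule exI[of _ ?g], rule exI[of _ \<rho>'],
      rule exI[of _ \<delta>], rule exI[of _ "2 * (dist p1 p3)\<^sup>2"], intro conjI ballI)
    show "\<delta> > 0" using \<rho>(1) \<rho>'(1) by (simp add: \<delta>_def)
    show "(\<lambda>s. p1) C1_differentiable_on {-\<delta><..<\<delta>}"
      by (rule C1_differentiable_on_const)
    show "\<rho> C1_differentiable_on {-\<delta><..<\<delta>}"
      by (rule C1_differentiable_on_subset[OF \<rho>(2) I(1)])
    show "?g C1_differentiable_on {-\<delta><..<\<delta>}"
      by (intro C1_differentiable_on_add C1_differentiable_on_scaleR C1_differentiable_on_const C1_differentiable_on_ident)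
    show "\<rho>' C1_differentiable_on {-\<delta><..<\<delta>}"
      by (rule C1_differentiable_on_subset[OF \<rho>'(2) I(2)])
    show "(p1, \<rho> s, ?g s, \<rho>' s) \<in> configurations a b c d" if "s \<in> {-\<delta><..<\<delta>}" for s
    proof -
      have "s \<in> {-\<epsilon><..<\<epsilon>}" "s \<in> {-\<epsilon>'<..<\<epsilon>'}"
        by (rule subsetD[OF I(1) that], rule subsetD[OF I(2) that])
      with \<rho>(4) \<rho>'(4) have "dist p1 (\<rho> s) = dist p1 p2" "dist (?g s) (\<rho> s) = dist p3 p2"
        "dist p1 (\<rho>' s) = dist p1 p4" "dist (?g s) (\<rho>' s) = dist p3 p4"
        by (simp_all only: Ball_def)
      moreover have "dist (\<rho> s) (?g s) = dist (?g s) (\<rho> s)" "dist (\<rho>' s) p1 = dist p1 (\<rho>' s)"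
        "dist p2 p3 = dist p3 p2" "dist p4 p1 = dist p1 p4"
        by (rule dist_commute)+
      ultimately show ?thesis
        using p by (simp only: configurations_def mem_Collect_eq case_prod_conv simp_thms)
    qed
    show "(p1, \<rho> 0, ?g 0, \<rho>' 0) = (p1, p2, p3, p4)"
      by (simp add: \<rho>(3) \<rho>'(3))
    have dg: "(dist p1 (?g s))\<^sup>2 = (1 + s)\<^sup>2 * (dist p1 p3)\<^sup>2" for s
      unfolding dist_plane_sq by (simp add: power2_eq_square algebra_simps)
    have "((\<lambda>s. (1 + s)\<^sup>2 * (dist p1 p3)\<^sup>2) has_real_derivative 2 * (dist p1 p3)\<^sup>2) (at 0)"
      by (rule derivative_eq_intros refl | simp)+
    then show "((\<lambda>s. (dist p1 (?g s))\<^sup>2) has_real_derivative 2 * (dist p1 p3)\<^sup>2) (at 0)"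
      by (simp only: dg)
    show "2 * (dist p1 p3)\<^sup>2 \<noteq> 0"
      using assms(2) by (auto simp: orient_coords)
  qed
qed

section \<open>The potential as a function of the diagonals\<close>

text \<open>As a function of the squared distance, the potential \<open>1 / X\<close> is strictly convex: the last
  summand is its excess over the tangent at \<open>x\<^sup>2\<close>.\<close>

lemma inverse_distance_tangent:
  fixes x X :: real
  assumes "x > 0" "X > 0"
  shows "1 / X = 1 / x - (X\<^sup>2 - x\<^sup>2) / (2 * x ^ 3) + (X - x)\<^sup>2 * (X + 2 * x) / (2 * x ^ 3 * X)"
  using assms by (simp add: field_simps power2_eq_square power3_eq_cube)

text \<open>The hypothesis \<open>crit\<close> says that \<open>(\<alpha>, \<beta>)\<close> is proportional to the negative gradient of
  the potential with respect to the squared diagonals. So the supporting line of the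
  attainable pairs is also the tangent of the level curve, and strict convexity puts all
  other attainable pairs at strictly higher potential.\<close>

lemma potential_strict_min_of_support:
  fixes x X y Y t \<alpha> \<beta> :: real
  assumes pos: "x > 0" "X > 0" "y > 0" "Y > 0" "t > 0"
    and ab: "\<alpha> \<ge> 0" "\<beta> \<ge> 0" "\<alpha> \<noteq> 0 \<or> \<beta> \<noteq> 0"
    and crit: "\<alpha> * x ^ 3 = \<beta> * t * y ^ 3"
    and support: "\<alpha> * (X\<^sup>2 - x\<^sup>2) + \<beta> * (Y\<^sup>2 - y\<^sup>2) \<le> 0"
    and ne: "X \<noteq> x \<or> Y \<noteq> y"
  shows "t / x + 1 / y < t / X + 1 / Y"
proof -
  have "\<beta> \<noteq> 0" using crit ab(3) pos by auto
  then have b: "\<beta> > 0" using ab(2) by simp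
  define A B where "A = X\<^sup>2 - x\<^sup>2" and "B = Y\<^sup>2 - y\<^sup>2"
  define A' B' where "A' = A / x ^ 3" and "B' = B / y ^ 3"
  have AB: "A = x ^ 3 * A'" "B = y ^ 3 * B'"
    using pos by (simp_all add: A'_def B'_def)
  have "\<alpha> * A + \<beta> * B = (\<alpha> * x ^ 3) * A' + \<beta> * y ^ 3 * B'"
    unfolding AB by (simp add: mult.assoc)
  also have "\<dots> = (\<beta> * y ^ 3) * (t * A' + B')"
    unfolding crit by (simp add: algebra_simps)
  finally have "(\<beta> * y ^ 3) * (t * A' + B') \<le> 0"
    using support by (simp add: A_def B_def)
  moreover have "\<beta> * y ^ 3 > 0" using b pos by simp
  ultimately have lin: "t * A' + B' \<le> 0"
    by (meson mult_pos_pos not_le)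
  define rx where "rx = (X - x)\<^sup>2 * (X + 2 * x) / (2 * x ^ 3 * X)"
  define ry where "ry = (Y - y)\<^sup>2 * (Y + 2 * y) / (2 * y ^ 3 * Y)"
  have r: "rx \<ge> 0" "ry \<ge> 0" and r0: "X \<noteq> x \<Longrightarrow> rx > 0" "Y \<noteq> y \<Longrightarrow> ry > 0"
    using pos by (simp_all add: rx_def ry_def)
  have "t * rx + ry > 0"
    using ne r r0 pos(5) by (metis add_nonneg_pos add_pos_nonneg mult_nonneg_nonneg mult_pos_pos less_imp_le)
  moreover have "t / X + 1 / Y = t / x + 1 / y - (t * A' + B') / 2 + (t * rx + ry)"
  proof -
    have 1: "1 / X = 1 / x - A' / 2 + rx"
      using inverse_distance_tangent[OF pos(1,2)] by (simp add: rx_def A'_def A_def)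
    have 2: "1 / Y = 1 / y - B' / 2 + ry"
      using inverse_distance_tangent[OF pos(3,4)] by (simp add: ry_def B'_def B_def)
    have "t / X = t * (1 / X)" by simp
    also have "\<dots> = t / x - t * A' / 2 + t * rx"
      unfolding 1 by (simp add: algebra_simps)
    finally show ?thesis unfolding 2 by (simp add: add_divide_distrib)
  qed
  moreover have "p < p - s / 2 + q" if "q > 0" "s \<le> 0" for p q s :: real
    using that by linarith
  ultimately show ?thesis using lin by (simp only:)
qed

lemma has_derivative_dist_sq:
  fixes g h :: "real \<Rightarrow> plane"
  assumes "(g has_vector_derivative g') (at x)" "(h has_vector_derivative h') (at x)"
  shows "((\<lambda>s. (dist (g s) (h s))\<^sup>2) has_real_derivative 2 * ((g x - h x) \<bullet> (g' - h'))) (at x)"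
proof -
  have "((\<lambda>s. g s - h s) has_derivative (\<lambda>s. s *\<^sub>R (g' - h'))) (at x)"
    using has_vector_derivative_diff[OF assms] by (simp add: has_vector_derivative_def)
  from has_derivative_inner[OF this this]
  have "((\<lambda>s. (g s - h s) \<bullet> (g s - h s)) has_derivative (\<lambda>s. (2 * ((g x - h x) \<bullet> (g' - h'))) * s)) (at x)"
    by (rule has_derivative_eq_rhs) (simp add: fun_eq_iff inner_commute algebra_simps)
  then show ?thesis
    by (simp add: has_field_derivative_def dist_norm power2_norm_eq_inner)
qed

lemma has_derivative_charge_over_root:
  fixes U :: "real \<Rightarrow> real"
  assumes "(U has_real_derivative u') (at z)" "U z = x\<^sup>2" "x > 0"
  shows "((\<lambda>s. t / sqrt (U s)) has_real_derivative - (t * u') / (2 * x ^ 3)) (at z)"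
proof -
  have "U z > 0" and sq: "sqrt (U z) = x" using assms by simp_all
  have "((\<lambda>s. sqrt (U s)) has_real_derivative inverse (sqrt (U z)) / 2 * u') (at z)"
    by (rule DERIV_chain2[where f = sqrt and g = U, OF DERIV_real_sqrt[OF \<open>U z > 0\<close>] assms(1)])
  from DERIV_divide[OF DERIV_const[of t] this]
  have "((\<lambda>s. t / sqrt (U s)) has_real_derivative
      (0 * sqrt (U z) - t * (inverse (sqrt (U z)) / 2 * u')) / (sqrt (U z) * sqrt (U z))) (at z)"
    using \<open>U z > 0\<close> by simp
  moreover have "(0 * sqrt (U z) - t * (inverse (sqrt (U z)) / 2 * u')) / (sqrt (U z) * sqrt (U z)) = - (t * u') / (2 * x ^ 3)"
    unfolding sq using assms(3) by (simp add: field_simps power3_eq_cube)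
  ultimately show ?thesis by simp
qed

lemma has_derivative_config_potential:
  assumes "((\<lambda>s. (dist (g1 s) (g3 s))\<^sup>2) has_real_derivative u') (at z)"
    and "((\<lambda>s. (dist (g2 s) (g4 s))\<^sup>2) has_real_derivative v') (at z)"
    and "g1 z \<noteq> g3 z" "g2 z \<noteq> g4 z"
  shows "((\<lambda>s. config_potential t (g1 s, g2 s, g3 s, g4 s)) has_real_derivative
     - (t * u') / (2 * dist (g1 z) (g3 z) ^ 3) + - (1 * v') / (2 * dist (g2 z) (g4 z) ^ 3)) (at z)"
proof -
  have "((\<lambda>s. t / sqrt ((dist (g1 s) (g3 s))\<^sup>2) + 1 / sqrt ((dist (g2 s) (g4 s))\<^sup>2)) has_real_derivative
     - (t * u') / (2 * dist (g1 z) (g3 z) ^ 3) + - (1 * v') / (2 * dist (g2 z) (g4 z) ^ 3)) (at z)"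
    by (intro DERIV_add has_derivative_charge_over_root assms(1,2)) (use assms(3,4) in simp_all)
  then show ?thesis
    by (simp add: config_potential_def)
qed

section \<open>Critical convex configurations\<close>

locale nondegenerate_linkage =
  fixes a b c d :: real
  assumes pos: "a > 0" "b > 0" "c > 0" "d > 0" and nondeg: "nondegenerate a b c d"
begin

lemma not_collinear: "(p1, p2, p3, p4) \<in> configurations a b c d \<Longrightarrow> \<not> collinear {p1, p2, p3, p4}"
  using nondeg by (auto simp: nondegenerate_def)

lemma vertices_distinct:
  assumes p: "(p1, p2, p3, p4) \<in> configurations a b c d"
  shows "p1 \<noteq> p2" "p2 \<noteq> p3" "p3 \<noteq> p4" "p4 \<noteq> p1" "p1 \<noteq> p3" "p2 \<noteq> p4"
proof -
  show "p1 \<noteq> p2" "p2 \<noteq> p3" "p3 \<noteq> p4" "p4 \<noteq> p1"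
    using p pos by (auto simp: configurations_def)
  show "p1 \<noteq> p3"
    using nondegenerate_imp_diagonal_nonzero[OF nondeg _ _ p] pos by simp
  show "p2 \<noteq> p4"
    using nondegenerate_imp_diagonal_nonzero[OF nondegenerate_rotate[OF nondeg] pos(2,1)] p
    unfolding configurations_rotate[of p1 p2 p3 p4] by blast
qed

text \<open>Any two of the four triangles share two vertices, and these are distinct points. So if
  two triangles are flat, the whole configuration lies on one line.\<close>

lemma opposite_orients_nonzero:
  assumes p: "(p1, p2, p3, p4) \<in> configurations a b c d"
  shows "orient p1 p2 p3 \<noteq> 0 \<and> orient p1 p3 p4 \<noteq> 0 \<or> orient p2 p3 p4 \<noteq> 0 \<and> orient p1 p2 p4 \<noteq> 0"
proof (rule ccontr)
  note ne = vertices_distinct[OF p] and nc = not_collinear[OF p]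
  have s: "orient p2 p3 p1 = orient p1 p2 p3" "orient p3 p4 p1 = orient p1 p3 p4" "orient p3 p4 p2 = orient p2 p3 p4"
    "orient p4 p1 p2 = orient p1 p2 p4" "orient p4 p1 p3 = orient p1 p3 p4"
    by (simp_all add: orient_coords algebra_simps)
  assume "\<not> ?thesis"
  then consider "orient p1 p2 p3 = 0" "orient p1 p2 p4 = 0" | "orient p2 p3 p1 = 0" "orient p2 p3 p4 = 0"
    | "orient p3 p4 p1 = 0" "orient p3 p4 p2 = 0" | "orient p4 p1 p2 = 0" "orient p4 p1 p3 = 0"
    unfolding s by argo
  then show False
  proof cases
    case 1 then show False using two_orients_0_imp_collinear[OF ne(1) 1] nc by (simp add: insert_commute)
  next
    case 2 then show False using two_orients_0_imp_collinear[OF ne(2) 2] nc by (simp add: insert_commute)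
  next
    case 3 then show False using two_orients_0_imp_collinear[OF ne(3) 3] nc by (simp add: insert_commute)
  next
    case 4 then show False using two_orients_0_imp_collinear[OF ne(4) 4] nc by (simp add: insert_commute)
  qed
qed

lemma convex_iff_diagonals_cross:
  assumes "p \<in> configurations a b c d"
  shows "convex_config p \<longleftrightarrow> diagonals_cross p"
proof -
  obtain p1 p2 p3 p4 where p: "p = (p1, p2, p3, p4)" by (cases p)
  note q = assms[unfolded p]
  show ?thesis
    unfolding p
    using convex_config_imp_diagonals_cross[OF _ vertices_distinct[OF q] not_collinear[OF q]]
      diagonals_cross_imp_convex_config[OF _ vertices_distinct(5,6)[OF q] not_collinear[OF q]]
    by (rule iffI)
qed

text \<open>At most one of the four triangles is flat, so at least one of the two diagonals has
  non-flat triangles on both of its sides, and that diagonal can be stretched.\<close>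

lemma diagonals_move:
  assumes p: "(p1, p2, p3, p4) \<in> configurations a b c d"
  shows "\<exists>g1 g2 g3 g4 \<epsilon> w. \<epsilon> > 0 \<and>
    g1 C1_differentiable_on {-\<epsilon><..<\<epsilon>} \<and> g2 C1_differentiable_on {-\<epsilon><..<\<epsilon>} \<and>
    g3 C1_differentiable_on {-\<epsilon><..<\<epsilon>} \<and> g4 C1_differentiable_on {-\<epsilon><..<\<epsilon>} \<and>
    (\<forall>s \<in> {-\<epsilon><..<\<epsilon>}. (g1 s, g2 s, g3 s, g4 s) \<in> configurations a b c d) \<and>
    (g1 0, g2 0, g3 0, g4 0) = (p1, p2, p3, p4) \<and> w \<noteq> 0 \<and>
    (((\<lambda>s. (dist (g1 s) (g3 s))\<^sup>2) has_real_derivative w) (at 0) \<or>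
     ((\<lambda>s. (dist (g2 s) (g4 s))\<^sup>2) has_real_derivative w) (at 0))"
  using opposite_orients_nonzero[OF p]
proof
  assume "orient p1 p2 p3 \<noteq> 0 \<and> orient p1 p3 p4 \<noteq> 0"
  then have "orient p1 p2 p3 \<noteq> 0" "orient p1 p3 p4 \<noteq> 0" by blast+
  from diagonal_motion[OF p this] obtain g1 g2 g3 g4 \<epsilon> u' where
    g: "\<epsilon> > 0" "g1 C1_differentiable_on {-\<epsilon><..<\<epsilon>}" "g2 C1_differentiable_on {-\<epsilon><..<\<epsilon>}"
    "g3 C1_differentiable_on {-\<epsilon><..<\<epsilon>}" "g4 C1_differentiable_on {-\<epsilon><..<\<epsilon>}"
    "\<forall>s \<in> {-\<epsilon><..<\<epsilon>}. (g1 s, g2 s, g3 s, g4 s) \<in> configurations a b c d"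
    "(g1 0, g2 0, g3 0, g4 0) = (p1, p2, p3, p4)"
    "((\<lambda>s. (dist (g1 s) (g3 s))\<^sup>2) has_real_derivative u') (at 0)" "u' \<noteq> 0"
    by (elim exE conjE)
  show ?thesis
    by (rule exI[of _ g1], rule exI[of _ g2], rule exI[of _ g3], rule exI[of _ g4],
        rule exI[of _ \<epsilon>], rule exI[of _ u']) (use g in simp)
next
  assume "orient p2 p3 p4 \<noteq> 0 \<and> orient p1 p2 p4 \<noteq> 0"
  moreover have "orient p2 p4 p1 = orient p1 p2 p4" by (rule orient_rotate)
  ultimately have ar: "orient p2 p3 p4 \<noteq> 0" "orient p2 p4 p1 \<noteq> 0" by simp_all
  have "(p2, p3, p4, p1) \<in> configurations b c d a"
    using p by (simp only: configurations_rotate[of p1 p2 p3 p4])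
  note motion = diagonal_motion[OF this ar]
  from motion obtain g1 g2 g3 g4 \<epsilon> u' where
    g: "\<epsilon> > 0" "g1 C1_differentiable_on {-\<epsilon><..<\<epsilon>}" "g2 C1_differentiable_on {-\<epsilon><..<\<epsilon>}"
    "g3 C1_differentiable_on {-\<epsilon><..<\<epsilon>}" "g4 C1_differentiable_on {-\<epsilon><..<\<epsilon>}"
    "\<forall>s \<in> {-\<epsilon><..<\<epsilon>}. (g1 s, g2 s, g3 s, g4 s) \<in> configurations b c d a"
    "(g1 0, g2 0, g3 0, g4 0) = (p2, p3, p4, p1)"
    "((\<lambda>s. (dist (g1 s) (g3 s))\<^sup>2) has_real_derivative u') (at 0)" "u' \<noteq> 0"
    by (elim exE conjE)
  show ?thesis
    by (rule exI[of _ g4], rule exI[of _ g1], rule exI[of _ g2], rule exI[of _ g3],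
        rule exI[of _ \<epsilon>], rule exI[of _ u'])
      (use g in \<open>simp add: configurations_rotate[of _ _ _ _ a b c d]\<close>)
qed

text \<open>Along a motion with \<open>(u', v') \<noteq> 0\<close>, where \<open>u'\<close> and \<open>v'\<close> are the speeds of the squared
  diagonals, the linear functional of \<open>stress_inequality\<close> has a maximum and the potential
  has a critical point. Both differentials annihilate \<open>(u', v')\<close>, so they are
  proportional, which is the hypothesis of \<open>potential_strict_min_of_support\<close>.\<close>

lemma critical_crossing_is_strict_min:
  assumes p: "p \<in> configurations a b c d" and cross: "diagonals_cross p" and t: "t > 0"
    and crit: "critical_point a b c d (coulomb_potential t) (config_class p)"
    and q: "q \<in> configurations a b c d" and ne: "config_class q \<noteq> config_class p"
  shows "config_potential t p < config_potential t q"
proof -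
  obtain p1 p2 p3 p4 where pp: "p = (p1, p2, p3, p4)" by (cases p)
  obtain q1 q2 q3 q4 where qq: "q = (q1, q2, q3, q4)" by (cases q)
  note p = p[unfolded pp] and q = q[unfolded qq]
  define \<alpha> where "\<alpha> = orient p2 p3 p4 * orient p1 p2 p4"
  define \<beta> where "\<beta> = orient p1 p3 p4 * orient p1 p2 p3"
  have ab: "\<alpha> \<ge> 0" "\<beta> \<ge> 0" "\<alpha> \<noteq> 0 \<or> \<beta> \<noteq> 0"
    using cross opposite_orients_nonzero[OF p] by (auto simp: \<alpha>_def \<beta>_def pp diagonals_cross_def)
  have support: "\<alpha> * ((dist r1 r3)\<^sup>2 - (dist p1 p3)\<^sup>2) + \<beta> * ((dist r2 r4)\<^sup>2 - (dist p2 p4)\<^sup>2) \<le> 0"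
    if "(r1, r2, r3, r4) \<in> configurations a b c d" for r1 r2 r3 r4
    using stress_inequality[OF p that] by (simp add: \<alpha>_def \<beta>_def)
  define x y where "x = dist p1 p3" and "y = dist p2 p4"
  have xy: "x > 0" "y > 0" using vertices_distinct[OF p] by (simp_all add: x_def y_def)
  from diagonals_move[OF p] obtain g1 g2 g3 g4 \<epsilon> w where
    g: "\<epsilon> > 0" "g1 C1_differentiable_on {-\<epsilon><..<\<epsilon>}" "g2 C1_differentiable_on {-\<epsilon><..<\<epsilon>}"
    "g3 C1_differentiable_on {-\<epsilon><..<\<epsilon>}" "g4 C1_differentiable_on {-\<epsilon><..<\<epsilon>}"
    "\<forall>s \<in> {-\<epsilon><..<\<epsilon>}. (g1 s, g2 s, g3 s, g4 s) \<in> configurations a b c d"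
    and g0: "(g1 0, g2 0, g3 0, g4 0) = (p1, p2, p3, p4)" and "w \<noteq> 0"
    and w: "((\<lambda>s. (dist (g1 s) (g3 s))\<^sup>2) has_real_derivative w) (at 0) \<or>
     ((\<lambda>s. (dist (g2 s) (g4 s))\<^sup>2) has_real_derivative w) (at 0)"
    by (elim exE conjE)
  have ex: "\<exists>h'. (h has_vector_derivative h') (at 0)" if "h C1_differentiable_on {-\<epsilon><..<\<epsilon>}" for h :: "real \<Rightarrow> plane"
    using that \<open>\<epsilon> > 0\<close> by (auto simp: C1_differentiable_on_def)
  obtain g1' g2' g3' g4' where g': "(g1 has_vector_derivative g1') (at 0)" "(g2 has_vector_derivative g2') (at 0)"
    "(g3 has_vector_derivative g3') (at 0)" "(g4 has_vector_derivative g4') (at 0)"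
    using ex[OF g(2)] ex[OF g(3)] ex[OF g(4)] ex[OF g(5)] by (elim exE)
  define u' v' where "u' = 2 * ((g1 0 - g3 0) \<bullet> (g1' - g3'))" and "v' = 2 * ((g2 0 - g4 0) \<bullet> (g2' - g4'))"
  have u: "((\<lambda>s. (dist (g1 s) (g3 s))\<^sup>2) has_real_derivative u') (at 0)"
    and v: "((\<lambda>s. (dist (g2 s) (g4 s))\<^sup>2) has_real_derivative v') (at 0)"
    unfolding u'_def v'_def by (rule has_derivative_dist_sq g')+
  have nz: "u' \<noteq> 0 \<or> v' \<noteq> 0"
    using w
  proof
    assume "((\<lambda>s. (dist (g1 s) (g3 s))\<^sup>2) has_real_derivative w) (at 0)"
    from DERIV_unique[OF u this] \<open>w \<noteq> 0\<close> show ?thesis by simp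
  next
    assume "((\<lambda>s. (dist (g2 s) (g4 s))\<^sup>2) has_real_derivative w) (at 0)"
    from DERIV_unique[OF v this] \<open>w \<noteq> 0\<close> show ?thesis by simp
  qed
  have z: "g1 0 = p1" "g2 0 = p2" "g3 0 = p3" "g4 0 = p4" using g0 by simp_all
  have lin: "\<alpha> * u' + \<beta> * v' = 0"
  proof (rule DERIV_local_max)
    show "((\<lambda>s. \<alpha> * (dist (g1 s) (g3 s))\<^sup>2 + \<beta> * (dist (g2 s) (g4 s))\<^sup>2) has_real_derivative \<alpha> * u' + \<beta> * v') (at 0)"
      by (intro DERIV_add DERIV_cmult u v)
    show "\<epsilon> > 0" by fact
    show "\<forall>s. \<bar>0 - s\<bar> < \<epsilon> \<longrightarrow> \<alpha> * (dist (g1 s) (g3 s))\<^sup>2 + \<beta> * (dist (g2 s) (g4 s))\<^sup>2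
        \<le> \<alpha> * (dist (g1 0) (g3 0))\<^sup>2 + \<beta> * (dist (g2 0) (g4 0))\<^sup>2"
    proof (intro allI impI)
      fix s assume "\<bar>0 - s\<bar> < \<epsilon>"
      then have "s \<in> {-\<epsilon><..<\<epsilon>}" by (simp add: abs_less_iff)
      then have "(g1 s, g2 s, g3 s, g4 s) \<in> configurations a b c d"
        by (rule bspec[OF g(6)])
      from support[OF this] show "\<alpha> * (dist (g1 s) (g3 s))\<^sup>2 + \<beta> * (dist (g2 s) (g4 s))\<^sup>2
        \<le> \<alpha> * (dist (g1 0) (g3 0))\<^sup>2 + \<beta> * (dist (g2 0) (g4 0))\<^sup>2"
        unfolding z by (simp add: right_diff_distrib)
    qed
  qed
  have "((\<lambda>s. config_potential t (g1 s, g2 s, g3 s, g4 s)) has_real_derivative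
     - (t * u') / (2 * x ^ 3) + - (1 * v') / (2 * y ^ 3)) (at 0)"
    using has_derivative_config_potential[OF u v, of t] vertices_distinct[OF p] by (simp add: z x_def y_def)
  moreover have "((\<lambda>s. config_potential t (g1 s, g2 s, g3 s, g4 s)) has_real_derivative 0) (at 0)"
  proof -
    let ?\<gamma> = "\<lambda>s. (g1 s, g2 s, g3 s, g4 s)"
    have "?\<gamma> C1_differentiable_on {-\<epsilon><..<\<epsilon>}"
      by (intro C1_differentiable_on_Pair g)
    moreover have "?\<gamma> ` {-\<epsilon><..<\<epsilon>} \<subseteq> configurations a b c d"
      using g(6) by blast
    moreover have "config_class (?\<gamma> 0) = config_class p"
      by (simp add: z pp)
    ultimately have "((\<lambda>s. coulomb_potential t (config_class (?\<gamma> s))) has_real_derivative 0) (at 0)"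
      using crit[unfolded critical_point_def, THEN conjunct2, THEN spec[of _ ?\<gamma>], THEN spec[of _ \<epsilon>]] \<open>\<epsilon> > 0\<close>
      by (simp only: simp_thms)
    then show ?thesis by (simp only: coulomb_potential_config_class)
  qed
  ultimately have "- (t * u') / (2 * x ^ 3) + - (1 * v') / (2 * y ^ 3) = 0"
    by (rule DERIV_unique)
  then have E: "t * y ^ 3 * u' = - (x ^ 3 * v')"
    using xy by (simp add: field_simps)
  \<comment> \<open>The determinant of the two linear relations between \<open>u'\<close> and \<open>v'\<close> must vanish.\<close>
  have balance: "\<alpha> * x ^ 3 = \<beta> * t * y ^ 3"
  proof -
    have "(\<alpha> * x ^ 3 - \<beta> * t * y ^ 3) * u' = x ^ 3 * (\<alpha> * u') - \<beta> * (t * y ^ 3 * u')"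
      by (simp add: algebra_simps)
    also have "\<dots> = x ^ 3 * (\<alpha> * u' + \<beta> * v')"
      unfolding E by (simp add: algebra_simps)
    finally have 1: "(\<alpha> * x ^ 3 - \<beta> * t * y ^ 3) * u' = 0" by (simp add: lin)
    have "(\<alpha> * x ^ 3 - \<beta> * t * y ^ 3) * v' = - \<alpha> * - (x ^ 3 * v') - t * y ^ 3 * (\<beta> * v')"
      by (simp add: algebra_simps)
    also have "\<dots> = - (t * y ^ 3) * (\<alpha> * u' + \<beta> * v')"
      unfolding E[symmetric] by (simp add: algebra_simps)
    finally have 2: "(\<alpha> * x ^ 3 - \<beta> * t * y ^ 3) * v' = 0" by (simp add: lin)
    show ?thesis using 1 2 nz by auto
  qed
  have differs: "dist q1 q3 \<noteq> x \<or> dist q2 q4 \<noteq> y"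
  proof (rule ccontr)
    assume "\<not> ?thesis"
    then have "config_class (p1, p2, p3, p4) = config_class (q1, q2, q3, q4)"
      using p q vertices_distinct(5)[OF p] by (intro config_class_eqI) (auto simp: configurations_def x_def y_def)
    with ne show False by (simp add: pp qq)
  qed
  have XY: "dist q1 q3 > 0" "dist q2 q4 > 0"
    using vertices_distinct(5,6)[OF q] by simp_all
  have "t / x + 1 / y < t / dist q1 q3 + 1 / dist q2 q4"
    by (rule potential_strict_min_of_support[OF xy(1) XY(1) xy(2) XY(2) t ab balance
          support[OF q, folded x_def y_def] differs])
  then show ?thesis
    by (simp add: pp qq config_potential_def x_def y_def)
qed

section \<open>Minimizers of the potential\<close>

definition minimal_config :: "real \<Rightarrow> config \<Rightarrow> bool" where
  "minimal_config t p \<longleftrightarrow> p \<in> configurations a b c d \<and>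
     (\<forall>q \<in> configurations a b c d. config_potential t p \<le> config_potential t q)"

lemma continuous_on_config_potential:
  "continuous_on (configurations a b c d \<times> UNIV) (\<lambda>(p, t). config_potential t p)"
proof -
  have eq: "(\<lambda>(p, t). config_potential t p) = (\<lambda>z. snd z / dist (fst (fst z)) (fst (snd (snd (fst z))))
      + 1 / dist (fst (snd (fst z))) (snd (snd (snd (fst z)))))"
    by (auto simp: config_potential_def fun_eq_iff)
  have "fst p \<noteq> fst (snd (snd p)) \<and> fst (snd p) \<noteq> snd (snd (snd p))" if "p \<in> configurations a b c d" for p
    using that vertices_distinct(5,6) by (cases p) auto
  then show ?thesis
    unfolding eq by (intro continuous_intros) auto
qed

lemma anchored_subset: "anchored a b c d \<subseteq> configurations a b c d"
  by (auto simp: anchored_def)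

lemma minimal_config_iff_anchored:
  assumes "p \<in> anchored a b c d"
  shows "minimal_config t p \<longleftrightarrow> (\<forall>q \<in> anchored a b c d. config_potential t p \<le> config_potential t q)"
proof -
  have "\<exists>r \<in> anchored a b c d. config_potential t r = config_potential t q" if q: "q \<in> configurations a b c d" for q
  proof -
    obtain r where "r \<in> anchored a b c d" "config_class r = config_class q"
      using anchored_representative[OF q] by blast
    then show ?thesis
      using coulomb_potential_config_class[of t r] coulomb_potential_config_class[of t q] by auto
  qed
  then have "(\<forall>q \<in> configurations a b c d. config_potential t p \<le> config_potential t q)
      \<longleftrightarrow> (\<forall>q \<in> anchored a b c d. config_potential t p \<le> config_potential t q)"
    using anchored_subset by fastforce
  then show ?thesis
    using assms anchored_subset by (auto simp: minimal_config_def)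
qed

lemma minimal_config_exists:
  assumes "configurations a b c d \<noteq> {}"
  shows "\<exists>p. minimal_config t p"
proof -
  have "anchored a b c d \<noteq> {}"
    using assms anchored_representative by (metis all_not_in_conv)
  moreover have "continuous_on (anchored a b c d) (config_potential t)"
  proof -
    have "continuous_on (anchored a b c d) ((\<lambda>(p, t). config_potential t p) \<circ> (\<lambda>p. (p, t)))"
      using anchored_subset
      by (intro continuous_on_compose continuous_on_subset[OF continuous_on_config_potential] continuous_intros) auto
    then show ?thesis by (simp add: o_def)
  qed
  ultimately obtain p where "p \<in> anchored a b c d" "\<forall>q \<in> anchored a b c d. config_potential t p \<le> config_potential t q"
    using continuous_attains_inf[OF compact_anchored, of a b c d "config_potential t"] by auto
  then have "minimal_config t p" using minimal_config_iff_anchored[of p t] by simp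
  then show ?thesis by (rule exI)
qed

text \<open>Lengthening one diagonal while keeping the other lowers the potential, so a reflection
  of a vertex in a diagonal cannot lengthen the other diagonal.\<close>

lemma minimal_config_diagonals_cross:
  assumes min: "minimal_config t p" and t: "t > 0"
  shows "diagonals_cross p"
proof -
  obtain p1 p2 p3 p4 where pp: "p = (p1, p2, p3, p4)" by (cases p)
  have p: "(p1, p2, p3, p4) \<in> configurations a b c d"
    using min by (simp add: minimal_config_def pp)
  have le: "t / dist p1 p3 + 1 / dist p2 p4 \<le> t / dist q1 q3 + 1 / dist q2 q4"
    if "(q1, q2, q3, q4) \<in> configurations a b c d" for q1 q2 q3 q4
    using min that unfolding minimal_config_def pp by (auto simp: config_potential_def)
  have "orient p1 p3 p4 * orient p1 p2 p3 \<ge> 0"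
  proof (rule opposite_sides_if_diagonal_maximal[OF p vertices_distinct(5)[OF p]])
    fix q1 q2 q3 q4 assume q: "(q1, q2, q3, q4) \<in> configurations a b c d" and "dist q1 q3 = dist p1 p3"
    then have "1 / dist p2 p4 \<le> 1 / dist q2 q4" using le[OF q] by simp
    then show "dist q2 q4 \<le> dist p2 p4"
      using vertices_distinct[OF q] vertices_distinct[OF p] by (simp add: field_simps)
  qed
  moreover have p': "(p2, p3, p4, p1) \<in> configurations b c d a"
    using p by (simp only: configurations_rotate[of p1 p2 p3 p4])
  have "orient p2 p4 p1 * orient p2 p3 p4 \<ge> 0"
  proof (rule opposite_sides_if_diagonal_maximal[OF p' vertices_distinct(6)[OF p]])
    fix q2 q3 q4 q1 assume "(q2, q3, q4, q1) \<in> configurations b c d a" and eq: "dist q2 q4 = dist p2 p4"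
    then have q: "(q1, q2, q3, q4) \<in> configurations a b c d"
      by (simp only: configurations_rotate[of q1 q2 q3 q4])
    have "t / dist p1 p3 \<le> t / dist q1 q3" using le[OF q] eq by simp
    then show "dist q3 q1 \<le> dist p3 p1"
      using vertices_distinct[OF q] vertices_distinct[OF p] t by (simp add: field_simps dist_commute)
  qed
  ultimately show ?thesis
    by (simp add: pp diagonals_cross_def orient_rotate[of p2 p4 p1] mult.commute)
qed

lemma minimal_config_critical:
  assumes min: "minimal_config t p"
  shows "critical_point a b c d (coulomb_potential t) (config_class p)"
  unfolding critical_point_def
proof (intro conjI allI impI)
  show "config_class p \<in> moduli_space a b c d"
    using min by (simp add: minimal_config_def moduli_space_def)
next
  fix \<gamma> :: "real \<Rightarrow> config" and \<epsilon> :: real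
  assume "\<epsilon> > 0 \<and> \<gamma> C1_differentiable_on {-\<epsilon><..<\<epsilon>} \<and> \<gamma> ` {-\<epsilon><..<\<epsilon>} \<subseteq> configurations a b c d \<and>
    config_class (\<gamma> 0) = config_class p"
  then have \<epsilon>: "\<epsilon> > 0" and C1: "\<gamma> C1_differentiable_on {-\<epsilon><..<\<epsilon>}"
    and sub: "\<And>s. s \<in> {-\<epsilon><..<\<epsilon>} \<Longrightarrow> \<gamma> s \<in> configurations a b c d" and 0: "config_class (\<gamma> 0) = config_class p"
    by auto
  have E0: "config_potential t (\<gamma> 0) = config_potential t p"
    using 0 by (metis coulomb_potential_config_class)
  obtain D where "\<forall>x\<in>{-\<epsilon><..<\<epsilon>}. (\<gamma> has_vector_derivative D x) (at x)"
    using C1 unfolding C1_differentiable_on_def by (elim exE conjE)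
  then have G: "(\<gamma> has_vector_derivative D 0) (at 0)"
    using \<epsilon> by simp
  define G where "G = D 0"
  note G = G[folded G_def]
  note snd' = bounded_linear.has_vector_derivative[OF bounded_linear_snd]
    and fst' = bounded_linear.has_vector_derivative[OF bounded_linear_fst]
  define g1 g2 g3 g4 where "g1 s = fst (\<gamma> s)" and "g2 s = fst (snd (\<gamma> s))"
    and "g3 s = fst (snd (snd (\<gamma> s)))" and "g4 s = snd (snd (snd (\<gamma> s)))" for s
  have \<gamma>: "\<gamma> s = (g1 s, g2 s, g3 s, g4 s)" for s
    by (simp add: g1_def g2_def g3_def g4_def)
  have g0: "(g1 0, g2 0, g3 0, g4 0) \<in> configurations a b c d"
    using sub[of 0] \<epsilon> by (simp add: \<gamma>)
  have g': "(g1 has_vector_derivative fst G) (at 0)" "(g2 has_vector_derivative fst (snd G)) (at 0)"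
    "(g3 has_vector_derivative fst (snd (snd G))) (at 0)" "(g4 has_vector_derivative snd (snd (snd G))) (at 0)"
    unfolding g1_def g2_def g3_def g4_def by (intro fst' snd' G)+
  obtain l where l: "((\<lambda>s. config_potential t (\<gamma> s)) has_real_derivative l) (at 0)"
    using has_derivative_config_potential[OF has_derivative_dist_sq[OF g'(1,3)] has_derivative_dist_sq[OF g'(2,4)]
        vertices_distinct(5,6)[OF g0], of t]
    unfolding \<gamma>[symmetric] by (rule that)
  moreover have "l = 0"
  proof (rule DERIV_local_min[OF l \<epsilon>], intro allI impI)
    fix s assume "\<bar>0 - s\<bar> < \<epsilon>"
    then have "\<gamma> s \<in> configurations a b c d" by (intro sub) auto
    then show "config_potential t (\<gamma> 0) \<le> config_potential t (\<gamma> s)"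
      using min by (simp add: E0 minimal_config_def)
  qed
  ultimately show "((\<lambda>s. coulomb_potential t (config_class (\<gamma> s))) has_real_derivative 0) (at 0)"
    by (simp add: coulomb_potential_config_class)
qed

section \<open>Continuous dependence on the charge\<close>

text \<open>The charges whose minimizer lies outside an open set \<open>U\<close> form a closed set: minimality is a
  closed condition on pairs of a configuration and a charge, and the projection to the charge
  is along a compact set of representatives, so it is a closed map.\<close>

lemma minimizer_class_continuous:
  assumes rep: "\<And>t. t > 0 \<Longrightarrow> P t \<in> moduli_space a b c d"
    and uniq: "\<And>t p. t > 0 \<Longrightarrow> p \<in> configurations a b c d \<Longrightarrow> minimal_config t p \<longleftrightarrow> config_class p = P t"
  shows "continuous_map (top_of_set {0<..}) (moduli_topology a b c d) P"
  unfolding continuous_map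
proof (intro conjI allI impI)
  show "P ` topspace (top_of_set {0<..}) \<subseteq> topspace (moduli_topology a b c d)"
    using rep by (auto simp: topspace_moduli_topology)
next
  fix U assume U: "openin (moduli_topology a b c d) U"
  let ?C = "configurations a b c d" and ?A = "anchored a b c d" and ?T = "{0::real<..}"
  have "openin (top_of_set ?C) {p \<in> ?C. config_class p \<in> U}"
    using U by (simp add: moduli_topology_def openin_quotient_topology)
  then obtain V where V: "open V" "{p \<in> ?C. config_class p \<in> U} = ?C \<inter> V"
    by (auto simp: openin_open)
  define K where "K = ?A - V"
  have "compact K" unfolding K_def using compact_anchored V(1) by (rule compact_diff)
  have KU: "p \<in> K \<longleftrightarrow> p \<in> ?A \<and> config_class p \<notin> U" for p
    using V(2) anchored_subset unfolding K_def by blast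
  define Z where "Z = {z \<in> K \<times> ?T. minimal_config (snd z) (fst z)}"
  have Zq: "closedin (top_of_set (K \<times> ?T)) {z \<in> K \<times> ?T. config_potential (snd z) (fst z) \<le> config_potential (snd z) q}"
    if q: "q \<in> ?A" for q
  proof -
    have "continuous_on (K \<times> ?T) ((\<lambda>(p, t). config_potential t p) \<circ> (\<lambda>z. z))"
      "continuous_on (K \<times> ?T) ((\<lambda>(p, t). config_potential t p) \<circ> (\<lambda>z. (q, snd z)))"
      using anchored_subset q KU
      by (intro continuous_on_compose continuous_on_subset[OF continuous_on_config_potential] continuous_intros; auto)+
    then have "continuous_on (K \<times> ?T) (\<lambda>z. config_potential (snd z) (fst z) - config_potential (snd z) q)"
      by (intro continuous_on_diff) (simp_all add: o_def case_prod_beta)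
    from continuous_closedin_preimage[OF this closed_atMost[of 0]]
    show ?thesis
      by (rule back_subst[of "closedin _"]) auto
  qed
  have anch: "\<exists>p \<in> ?A. config_class p = P t" if t: "t > 0" for t
  proof -
    obtain q where "q \<in> ?C" "P t = config_class q"
      using rep[OF t] unfolding moduli_space_def by blast
    then show ?thesis using anchored_representative[of q a b c d] by simp
  qed
  have "?A \<noteq> {}"
    using anch[of 1] by auto
  then have "closedin (top_of_set (K \<times> ?T)) (\<Inter>q\<in>?A. {z \<in> K \<times> ?T. config_potential (snd z) (fst z) \<le> config_potential (snd z) q})"
    using Zq by (intro closedin_Inter) auto
  moreover have "(\<Inter>q\<in>?A. {z \<in> K \<times> ?T. config_potential (snd z) (fst z) \<le> config_potential (snd z) q}) = Z"
    using \<open>?A \<noteq> {}\<close> minimal_config_iff_anchored by (auto simp: Z_def KU)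
  ultimately have "closedin (top_of_set ?T) {t. \<exists>p. p \<in> K \<and> (p, t) \<in> Z}"
    using closedin_compact_projection[OF \<open>compact K\<close>] by simp
  moreover have "{t. \<exists>p. p \<in> K \<and> (p, t) \<in> Z} = ?T - {t \<in> ?T. P t \<in> U}"
  proof -
    have "(\<exists>p. p \<in> K \<and> (p, t) \<in> Z) \<longleftrightarrow> P t \<notin> U" if t: "t > 0" for t
    proof
      assume "\<exists>p. p \<in> K \<and> (p, t) \<in> Z"
      then obtain p where "p \<in> K" "minimal_config t p" by (auto simp: Z_def)
      then show "P t \<notin> U"
        using uniq[OF t, of p] anchored_subset KU by auto
    next
      assume nU: "P t \<notin> U"
      obtain p where p: "p \<in> ?A" "config_class p = P t"
        using anch[OF t] by blast
      then have "minimal_config t p"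
        using uniq[OF t, of p] anchored_subset by auto
      moreover have "p \<in> K" using p nU by (simp add: KU)
      ultimately have "(p, t) \<in> Z" using t by (simp add: Z_def)
      with \<open>p \<in> K\<close> show "\<exists>p. p \<in> K \<and> (p, t) \<in> Z" by blast
    qed
    moreover have "t > 0" if "(p, t) \<in> Z" for p t
      using that by (simp add: Z_def)
    ultimately show ?thesis by blast
  qed
  ultimately have "closedin (top_of_set ?T) (?T - {t \<in> ?T. P t \<in> U})"
    by (simp only:)
  then have "openin (top_of_set ?T) {t \<in> ?T. P t \<in> U}"
    by (subst openin_closedin_eq) auto
  then show "openin (top_of_set ?T) {t \<in> topspace (top_of_set ?T). P t \<in> U}"
    by simp
qed

end

section \<open>The critical convex configuration\<close>

theorem mainTheorem1:
  fixes a b c d :: real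
  assumes "a > 0" and "b > 0" and "c > 0" and "d > 0"
    and "moduli_space a b c d \<noteq> {}"
    and "nondegenerate a b c d"
  shows "\<exists>P :: real \<Rightarrow> config set.
    (\<forall>t>0.
       {m \<in> convex_moduli_space a b c d. critical_point a b c d (coulomb_potential t) m} = {P t} \<and>
       (\<forall>m \<in> moduli_space a b c d. m \<noteq> P t \<longrightarrow> coulomb_potential t (P t) < coulomb_potential t m)) \<and>
    continuous_map (top_of_set {0<..}) (moduli_topology a b c d) P"
proof -
  interpret nondegenerate_linkage a b c d
    using assms by unfold_locales
  have ne: "configurations a b c d \<noteq> {}"
    using assms(5) by (auto simp: moduli_space_def)
  define m where "m t = (SOME p. minimal_config t p)" for t
  have m: "minimal_config t (m t)" for t
    unfolding m_def using minimal_config_exists[OF ne] by (rule someI_ex)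
  then have mc: "m t \<in> configurations a b c d" for t
    by (simp add: minimal_config_def)
  have strict: "config_potential t (m t) < config_potential t q"
    if "t > 0" "q \<in> configurations a b c d" "config_class q \<noteq> config_class (m t)" for t q
    by (rule critical_crossing_is_strict_min[OF mc minimal_config_diagonals_cross[OF m that(1)]
          that(1) minimal_config_critical[OF m] that(2,3)])
  show ?thesis
  proof (intro exI[of _ "\<lambda>t. config_class (m t)"] conjI allI impI ballI)
    fix t :: real assume t: "t > 0"
    show "{k \<in> convex_moduli_space a b c d. critical_point a b c d (coulomb_potential t) k} = {config_class (m t)}"
    proof (intro equalityI subsetI)
      fix k assume "k \<in> {k \<in> convex_moduli_space a b c d. critical_point a b c d (coulomb_potential t) k}"
      then obtain p where p: "p \<in> configurations a b c d" "convex_config p" "k = config_class p"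
        "critical_point a b c d (coulomb_potential t) (config_class p)"
        by (auto simp: convex_moduli_space_def)
      then have "diagonals_cross p" using convex_iff_diagonals_cross by blast
      then have "config_class (m t) = config_class p"
        using critical_crossing_is_strict_min[OF p(1) _ t p(4) mc] strict[OF t p(1)] by fastforce
      then show "k \<in> {config_class (m t)}" by (simp add: p(3))
    next
      fix k assume "k \<in> {config_class (m t)}"
      moreover have "convex_config (m t)"
        using convex_iff_diagonals_cross[OF mc] minimal_config_diagonals_cross[OF m t] by blast
      ultimately show "k \<in> {k \<in> convex_moduli_space a b c d. critical_point a b c d (coulomb_potential t) k}"
        using minimal_config_critical[OF m] mc by (auto simp: convex_moduli_space_def)
    qed
    fix k assume "k \<in> moduli_space a b c d" "k \<noteq> config_class (m t)"
    then obtain q where "q \<in> configurations a b c d" "k = config_class q" "config_class q \<noteq> config_class (m t)"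
      unfolding moduli_space_def by blast
    then show "coulomb_potential t (config_class (m t)) < coulomb_potential t k"
      using strict[OF t] by (simp add: coulomb_potential_config_class)
  next
    show "continuous_map (top_of_set {0<..}) (moduli_topology a b c d) (\<lambda>t. config_class (m t))"
    proof (rule minimizer_class_continuous)
      show "config_class (m t) \<in> moduli_space a b c d" for t
        using mc by (simp add: moduli_space_def)
      show "minimal_config t p \<longleftrightarrow> config_class p = config_class (m t)"
        if "t > 0" "p \<in> configurations a b c d" for t p
      proof
        assume "minimal_config t p"
        then show "config_class p = config_class (m t)"
          using strict[OF that] mc[of t] by (force simp: minimal_config_def)
      next
        assume "config_class p = config_class (m t)"
        then have "config_potential t p = config_potential t (m t)"
          by (metis coulomb_potential_config_class)
        then show "minimal_config t p"
          using m[of t] that(2) by (simp add: minimal_config_def)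
      qed
    qed
  qed
qed

end
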